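(* Let $n\ge0$, $d\ge1$ be integers, $N=\binom{n+d}{d}-1$, let $\mathbf q$ be an $(n+1)\times(n+1)$ multiplicatively anti-symmetric complex matrix and let $\mathcal{A}=\mathcal{A}^n_{\mathbf q}$. The $d$-Veronese subalgebra $\mathcal{A}^{(d)}=\bigoplus_{k\ge0}\mathcal{A}_{kd}\subseteq\mathcal{A}$ is a quadratic algebra with $\binom{n+d}{d}$ generators, namely the elements $w_0,\dots,w_N$ of $(\mathcal{T}^n)_d$, subject to $(N+1)^2-\binom{n+2d}{n}$ independent quadratic relations which split into two disjoint sets $\mathcal{R}_1$ and $\mathcal{R}_2$ given below. (1) The set $\mathcal{R}_1$ contains exactly $\binom{N+1}{2}$ relations $$\mathcal{R}_1=\{f_{ji}=w_jw_i-\varphi_{ji}w_{i'}w_{j'}\mid 0\le i<j\le N,\ (i',j')\in\mathrm{C}(n,2,d),\ \varphi_{ji}\in\mathbb{C}^\times\},$$ where for each pair $j>i$ the product $w_jw_i$ occurs exactly once in $\mathcal{R}_1$, and there is a unique pair $(i',j')\in\mathrm{C}(n,2,d)$ such that $\mathrm{Nor}(w_jw_i)=\varphi_{ji}w_{i'}w_{j'}=\varphi_{ji}T_\beta$, with $\beta=\deg(w_jw_i)=\deg(w_{i'}w_{j'})$. One has $\mathbf{LM}(f_{ji})=w_jw_i>w_{i'}w_{j'}=T_\beta\in(\mathcal{T}^n)_{2d}$. Moreover, for every pair $(i,j)\in\mathrm{C}(n,2,d)$ with $i<j$, the product $w_iw_j=T_\beta\in(\mathcal{T}^n)_{2d}$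 occurs in a relation $w_jw_i-\varphi_{ji}w_iw_j\in\mathcal{R}_1$. Each coefficient $\varphi_{ji}$ is a non-zero complex number uniquely determined by $\mathbf q$. (2) The set $\mathcal{R}_2$ consists of exactly $\binom{N+2}{2}-\binom{n+2d}{n}$ relations $$\mathcal{R}_2=\{f_{ij}=w_iw_j-\varphi_{ij}w_{i'}w_{j'}\mid (i,j)\in\mathrm{MV}(n,d),\ (i',j')\in\mathrm{C}(n,2,d),\ \varphi_{ij}\in\mathbb{C}^\times\},$$ where for each pair $(i,j)\in\mathrm{MV}(n,d)$ the word $w_iw_j$ occurs exactly once in $\mathcal{R}_2$, and determines uniquely a pair $(i',j')\in\mathrm{C}(n,2,d)$ with $i'<j'$ and a nonzero complex number $\varphi_{ij}$ such that $\mathrm{Nor}(w_iw_j)=\varphi_{ij}w_{i'}w_{j'}=\varphi_{ij}T_\beta$, with $\beta=\deg(w_iw_j)=\deg(w_{i'}w_{j'})$. In particular, $\mathbf{LM}(f_{ij})=w_iw_j>w_{i'}w_{j'}=T_\beta\in(\mathcal{T}^n)_{2d}$. (3) The relations $\mathcal{R}_1\cup\mathcal{R}_2$ imply a set $\mathcal{R}_1'$ of $\binom{N+1}{2}$ additional relations $$\mathcal{R}_1'=\{w_jw_i-g_{ji}w_iw_j\mid g_{ji}\in\mathbb{C}^\times,\ 0\le i<j\le N\},$$ where for each $i<j$ the coefficient $g_{ji}=\varphi_{ji}/\varphi_{ij}$ is uniquely determined by the matrix $\mathbf q$; here $\varphi_{ij}=1$ whenever $(i,j)\in\mathrm{C}(n,2,d)$.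 (4) Conversely, the relations $\mathcal{R}'=\mathcal{R}_1'\cup\mathcal{R}_2$ imply the relations $\mathcal{R}_1$. Moreover, $\mathcal{R}'$ is also a complete set of independent relations for the $d$-Veronese algebra $\mathcal{A}^{(d)}$.
   Context: A square complex matrix $\mathbf q=\|q_{ij}\|$ is multiplicatively anti-symmetric if all $q_{ij}\in\mathbb{C}^\times$, $q_{ji}=q_{ij}^{-1}$ and $q_{ii}=1$. For such an $(n+1)\times(n+1)$ matrix (indices $0,\dots,n$), the quantum space is $\mathcal{A}^n_{\mathbf q}=\mathbb{C}\langle x_0,\dots,x_n\rangle/(x_jx_i-q_{ji}x_ix_j\mid 0\le i<j\le n)$, graded by length. Words in the $x_i$ are ordered degree-lexicographically with $x_0<\dots<x_n$. The multi-degree $\deg(u)=\alpha\in\mathbb{N}_0^{n+1}$ of a word $u$ counts occurrences of each letter, and $T_\alpha=x_0^{\alpha_0}\cdots x_n^{\alpha_n}$. An ordered monomial is a word of the form $T_\alpha$; $(\mathcal{T}^n)_p$ is the set of ordered monomials of length $p$. The ordered monomials form a $\mathbb{C}$-basis of $\mathcal{A}^n_{\mathbf q}$; $\mathrm{Nor}(f)$ is the unique linear combination of ordered monomials equal to $f$ in $\mathcal{A}^n_{\mathbf q}$. For a word $u$ of multi-degree $\alpha$, $\mathrm{Nor}(u)=\zeta_uT_\alpha$ with a unique $\zeta_u\in\mathbb{C}^\times$. $\mathbf{LM}$ denotes the leading monomial with respect to $<$ (of the polynomial viewed in the free algebra). Enumerate $(\mathcal{T}^n)_d=\{w_0=x_0^d<w_1<\dots<w_N=x_n^d\}$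 lexicographically. For $0\le j\le N$, $m(j)$ and $M(j)$ are the smallest and largest index $s$ such that $x_s$ occurs in $w_j$. Set $\mathrm{P}(n,d)=\{(i,j)\mid 0\le i\le j\le N\}$, $\mathrm{C}(n,2,d)=\{(i,j)\in\mathrm{P}(n,d)\mid M(i)\le m(j)\}$ (equivalently $w_iw_j\in(\mathcal{T}^n)_{2d}$ as a word), $\mathrm{MV}(n,d)=\{(i,j)\in\mathrm{P}(n,d)\mid M(i)>m(j)\}$. Relations are understood as elements of the free associative algebra on symbols $w_0,\dots,w_N$ in which the products $w_aw_b$ are formal words of length two; "a set of relations implies another" means that the second set lies in the two-sided ideal generated by the first; "independent" means linearly independent; a "complete set of relations for $\mathcal{A}^{(d)}$" is one generating the kernel of the canonical surjection from this free algebra onto $\mathcal{A}^{(d)}$. *)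

theory Defs
  imports
    Complex_Main
    "HOL-Library.Poly_Mapping"
    "HOL-Library.List_Lenlexorder"
    "HOL-Algebra.QuotRing"
    "HOL-Algebra.Subrings"
begin

section \<open>Free associative algebras\<close>

text \<open>
  A word in letters $0, 1, 2, \dots$ is a list of natural numbers.  The order on words provided by
  \<^theory>\<open>HOL-Library.List_Lenlexorder\<close> (length first, then lexicographic) is the
  degree-lexicographic order with $x_0 < x_1 < \dots$.  Words form a monoid under
  concatenation; written additively, this makes the finitely supported functions from words to
  complex numbers, with the convolution product of \<^theory>\<open>HOL-Library.Poly_Mapping\<close>, the
  free associative algebra on countably many letters.
\<close>

instantiation list :: (type) monoid_add
begin

definition zero_list :: "'a list" where "zero_list = []"

definition plus_list :: "'a list \<Rightarrow> 'a list \<Rightarrow> 'a list" where "plus_list = (@)"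

instance by standard (simp_all add: zero_list_def plus_list_def)

end

type_synonym word = "nat list"
type_synonym npoly = "word \<Rightarrow>\<^sub>0 complex"

definition mon :: "word \<Rightarrow> npoly" where
  "mon u = Poly_Mapping.single u 1"

definition scaleF :: "complex \<Rightarrow> npoly \<Rightarrow> npoly" (infixr \<open>*\<^sub>F\<close> 75) where
  "c *\<^sub>F f = Poly_Mapping.map ((*) c) f"

lemma lookup_scaleF: "Poly_Mapping.lookup (c *\<^sub>F f) u = c * Poly_Mapping.lookup f u"
  by (simp add: scaleF_def map.rep_eq when_def)

interpretation npoly: vector_space scaleF
  by standard (auto intro!: poly_mapping_eqI simp: lookup_scaleF lookup_add algebra_simps)

definition free_algebra :: "nat \<Rightarrow> npoly ring" where
  "free_algebra n = \<lparr>carrier = {f. \<forall>u\<in>Poly_Mapping.keys f. set u \<subseteq> {..n}},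
     mult = (*), one = 1, zero = 0, add = (+)\<rparr>"

lemma ring_free_algebra: "ring (free_algebra n)"
proof (rule ringI)
  show "abelian_group (free_algebra n)"
  proof (rule abelian_groupI)
    fix f assume "f \<in> carrier (free_algebra n)"
    then show "\<exists>g\<in>carrier (free_algebra n).
        g \<oplus>\<^bsub>free_algebra n\<^esub> f = \<zero>\<^bsub>free_algebra n\<^esub>"
      by (intro bexI[of _ "- f"]) (auto simp: free_algebra_def)
  qed (use Poly_Mapping.keys_add in \<open>fastforce simp: free_algebra_def algebra_simps\<close>)+
  show "monoid (free_algebra n)"
  proof (rule monoidI)
    fix f g assume fg: "f \<in> carrier (free_algebra n)" "g \<in> carrier (free_algebra n)"
    have "Poly_Mapping.keys (f * g) \<subseteq>
        {u + v | u v. u \<in> Poly_Mapping.keys f \<and> v \<in> Poly_Mapping.keys g}"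
      by (rule keys_mult)
    with fg show "f \<otimes>\<^bsub>free_algebra n\<^esub> g \<in> carrier (free_algebra n)"
      by (fastforce simp: free_algebra_def plus_list_def)
  qed (auto simp: free_algebra_def zero_list_def mult.assoc)
qed (auto simp: free_algebra_def algebra_simps)

definition homogeneous :: "nat \<Rightarrow> nat \<Rightarrow> npoly set" where
  "homogeneous n k =
     {f \<in> carrier (free_algebra n). \<forall>u\<in>Poly_Mapping.keys f. length u = k}"

definition LM :: "npoly \<Rightarrow> word" where
  "LM f = Max (Poly_Mapping.keys f)"


section \<open>Quantum spaces\<close>

definition mult_antisym :: "nat \<Rightarrow> (nat \<Rightarrow> nat \<Rightarrow> complex) \<Rightarrow> bool" where
  "mult_antisym n q \<longleftrightarrow>
     (\<forall>i\<le>n. \<forall>j\<le>n. q i j \<noteq> 0 \<and> q j i = inverse (q i j)) \<and> (\<forall>i\<le>n. q i i = 1)"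

definition qrelations :: "nat \<Rightarrow> (nat \<Rightarrow> nat \<Rightarrow> complex) \<Rightarrow> npoly set" where
  "qrelations n q = {mon [j, i] - q j i *\<^sub>F mon [i, j] | i j. i < j \<and> j \<le> n}"

definition qideal :: "nat \<Rightarrow> (nat \<Rightarrow> nat \<Rightarrow> complex) \<Rightarrow> npoly set" where
  "qideal n q = Idl\<^bsub>free_algebra n\<^esub> (qrelations n q)"

definition qspace :: "nat \<Rightarrow> (nat \<Rightarrow> nat \<Rightarrow> complex) \<Rightarrow> npoly set ring" where
  "qspace n q = free_algebra n Quot qideal n q"

definition qclass :: "nat \<Rightarrow> (nat \<Rightarrow> nat \<Rightarrow> complex) \<Rightarrow> npoly \<Rightarrow> npoly set" where
  "qclass n q f = qideal n q +>\<^bsub>free_algebra n\<^esub> f"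

definition qcomponent :: "nat \<Rightarrow> (nat \<Rightarrow> nat \<Rightarrow> complex) \<Rightarrow> nat \<Rightarrow> npoly set set" where
  "qcomponent n q k = qclass n q ` homogeneous n k"

definition mdeg :: "word \<Rightarrow> nat \<Rightarrow> nat" where
  "mdeg u = (\<lambda>s. count_list u s)"

definition Tmon :: "nat \<Rightarrow> (nat \<Rightarrow> nat) \<Rightarrow> word" where
  "Tmon n \<alpha> = concat (map (\<lambda>s. replicate (\<alpha> s) s) [0..<Suc n])"

definition ordered_monomials :: "nat \<Rightarrow> nat \<Rightarrow> word set" where
  "ordered_monomials n p = {u. (\<exists>\<alpha>. u = Tmon n \<alpha>) \<and> length u = p}"

definition Nor :: "nat \<Rightarrow> (nat \<Rightarrow> nat \<Rightarrow> complex) \<Rightarrow> npoly \<Rightarrow> npoly" where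
  "Nor n q f = (THE g. Poly_Mapping.keys g \<subseteq> range (Tmon n) \<and> qclass n q g = qclass n q f)"

definition zeta :: "nat \<Rightarrow> (nat \<Rightarrow> nat \<Rightarrow> complex) \<Rightarrow> word \<Rightarrow> complex" where
  "zeta n q u = (THE c. c \<noteq> 0 \<and> Nor n q (mon u) = c *\<^sub>F mon (Tmon n (mdeg u)))"


section \<open>The Veronese subalgebra\<close>

definition veronese :: "nat \<Rightarrow> (nat \<Rightarrow> nat \<Rightarrow> complex) \<Rightarrow> nat \<Rightarrow> npoly set set" where
  "veronese n q d =
     {finsum (qspace n q) a K | a K. finite K \<and> (\<forall>k\<in>K. a k \<in> qcomponent n q (k * d))}"

definition veronese_ring :: "nat \<Rightarrow> (nat \<Rightarrow> nat \<Rightarrow> complex) \<Rightarrow> nat \<Rightarrow> npoly set ring" where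
  "veronese_ring n q d = (qspace n q)\<lparr>carrier := veronese n q d\<rparr>"

definition wd :: "nat \<Rightarrow> nat \<Rightarrow> nat \<Rightarrow> word" where
  "wd n d i = sorted_list_of_set (ordered_monomials n d) ! i"

definition Nver :: "nat \<Rightarrow> nat \<Rightarrow> nat" where
  "Nver n d = ((n + d) choose d) - 1"

text \<open>
  The free algebra on the symbols $w_0, \dots, w_N$ is \<open>free_algebra N\<close>, with letter \<open>i\<close> standing
  for $w_i$.  The following linear map is the algebra homomorphism to the free algebra on
  $x_0, \dots, x_n$ replacing each symbol by the word it denotes.
\<close>

definition expand :: "nat \<Rightarrow> nat \<Rightarrow> npoly \<Rightarrow> npoly" where
  "expand n d f =
     (\<Sum>u\<in>Poly_Mapping.keys f. Poly_Mapping.lookup f u *\<^sub>F mon (concat (map (wd n d) u)))"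

definition veronese_map ::
    "nat \<Rightarrow> (nat \<Rightarrow> nat \<Rightarrow> complex) \<Rightarrow> nat \<Rightarrow> npoly \<Rightarrow> npoly set" where
  "veronese_map n q d f = qclass n q (expand n d f)"

definition complete_relations ::
    "nat \<Rightarrow> (nat \<Rightarrow> nat \<Rightarrow> complex) \<Rightarrow> nat \<Rightarrow> npoly set \<Rightarrow> bool" where
  "complete_relations n q d R \<longleftrightarrow> R \<subseteq> carrier (free_algebra (Nver n d)) \<and>
     a_kernel (free_algebra (Nver n d)) (veronese_ring n q d) (veronese_map n q d) =
       Idl\<^bsub>free_algebra (Nver n d)\<^esub> R"

definition mfirst :: "nat \<Rightarrow> nat \<Rightarrow> nat \<Rightarrow> nat" where
  "mfirst n d j = Min (set (wd n d j))"

definition mlast :: "nat \<Rightarrow> nat \<Rightarrow> nat \<Rightarrow> nat" where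
  "mlast n d j = Max (set (wd n d j))"

definition Ppairs :: "nat \<Rightarrow> nat \<Rightarrow> (nat \<times> nat) set" where
  "Ppairs n d = {(i, j). i \<le> j \<and> j \<le> Nver n d}"

definition Cpairs :: "nat \<Rightarrow> nat \<Rightarrow> (nat \<times> nat) set" where
  "Cpairs n d = {(i, j) \<in> Ppairs n d. mlast n d i \<le> mfirst n d j}"

definition MVpairs :: "nat \<Rightarrow> nat \<Rightarrow> (nat \<times> nat) set" where
  "MVpairs n d = {(i, j) \<in> Ppairs n d. mlast n d i > mfirst n d j}"

text \<open>
  \<open>normal_pair n q d a b i' j' c\<close> says that $\mathrm{Nor}(w_a w_b) = c\, w_{i'} w_{j'}$ with
  $(i', j') \in \mathrm{C}(n,2,d)$ and $c \ne 0$; \<open>rel a b i' j' c\<close> is the corresponding formal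
  relation $w_a w_b - c\, w_{i'} w_{j'}$.
\<close>

definition normal_pair :: "nat \<Rightarrow> (nat \<Rightarrow> nat \<Rightarrow> complex) \<Rightarrow> nat \<Rightarrow>
    nat \<Rightarrow> nat \<Rightarrow> nat \<Rightarrow> nat \<Rightarrow> complex \<Rightarrow> bool" where
  "normal_pair n q d a b i' j' c \<longleftrightarrow> (i', j') \<in> Cpairs n d \<and> c \<noteq> 0 \<and>
     Nor n q (mon (wd n d a @ wd n d b)) = c *\<^sub>F mon (wd n d i' @ wd n d j')"

definition rel :: "nat \<Rightarrow> nat \<Rightarrow> nat \<Rightarrow> nat \<Rightarrow> complex \<Rightarrow> npoly" where
  "rel a b i' j' c = mon [a, b] - c *\<^sub>F mon [i', j']"

definition phi :: "nat \<Rightarrow> (nat \<Rightarrow> nat \<Rightarrow> complex) \<Rightarrow> nat \<Rightarrow> nat \<Rightarrow> nat \<Rightarrow> complex" where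
  "phi n q d a b = zeta n q (wd n d a @ wd n d b)"

definition gcoeff :: "nat \<Rightarrow> (nat \<Rightarrow> nat \<Rightarrow> complex) \<Rightarrow> nat \<Rightarrow> nat \<Rightarrow> nat \<Rightarrow> complex" where
  "gcoeff n q d j i = phi n q d j i / phi n q d i j"

definition R1 :: "nat \<Rightarrow> (nat \<Rightarrow> nat \<Rightarrow> complex) \<Rightarrow> nat \<Rightarrow> npoly set" where
  "R1 n q d =
     {rel j i i' j' c | i j i' j' c. i < j \<and> j \<le> Nver n d \<and> normal_pair n q d j i i' j' c}"

definition R2 :: "nat \<Rightarrow> (nat \<Rightarrow> nat \<Rightarrow> complex) \<Rightarrow> nat \<Rightarrow> npoly set" where
  "R2 n q d =
     {rel i j i' j' c | i j i' j' c. (i, j) \<in> MVpairs n d \<and> normal_pair n q d i j i' j' c}"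

definition R1' :: "nat \<Rightarrow> (nat \<Rightarrow> nat \<Rightarrow> complex) \<Rightarrow> nat \<Rightarrow> npoly set" where
  "R1' n q d = {rel j i i j (gcoeff n q d j i) | i j. i < j \<and> j \<le> Nver n d}"

end

theory Submission
  imports Defs "HOL-Library.Multiset"
begin

text \<open>
  Every word \<open>u\<close> equals a nonzero scalar times its sorted rearrangement in the quantum space; the
  scalar is the product of the \<open>q a b\<close> over all inversions of \<open>u\<close>.  The linear map \<open>nform\<close> with these
  values satisfies \<open>nform (f * g) = nform (nform f * nform g)\<close>, so its kernel is an ideal, and this
  ideal is exactly the defining one.  Hence two elements agree in the quantum space iff they have
  the same image under \<open>nform\<close>.

  In the free algebra on the \<open>w i\<close>, the relations rewrite \<open>w a w b\<close> outside \<open>Cpairs\<close> to a smaller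
  word, so every word reduces to one all of whose adjacent pairs lie in \<open>Cpairs\<close>.  Such words expand
  to pairwise distinct ordered monomials, so nothing else is in the kernel of the Veronese map.
  Both families of relations have pairwise distinct leading monomials and are therefore independent.
\<close>

section \<open>Linear extension\<close>

text \<open>The obstacle is the linear independence of ordered monomials: rewriting alone shows only
  that they span, and a confluence check on overlapping words would have to supply the rest. The
  explicit inversion product avoids this, because it defines a map on the free algebra before any
  quotient is taken. For the Veronese algebra only the existence of reductions is proved; confluence
  is replaced by the fact that normal words already have linearly independent images. Termination on
  symbol words comes from the words in the letters x: all \<open>w i\<close> have length
  \<open>d\<close> and are enumerated increasingly, so index words of equal length compare as their
  expansions do. Both presentations have the same leading words, indexed by
  \<open>red_pairs\<close>, so one criterion for the kernel settles both. The counts come from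
  cutting a sorted word of length \<open>2 * d\<close> in the middle.\<close>

lemma lookup_mon: "Poly_Mapping.lookup (mon u) v = (if u = v then 1 else 0)"
  by (simp add: mon_def lookup_single when_def)

lemma keys_mon [simp]: "Poly_Mapping.keys (mon u) = {u}"
  by (simp add: mon_def)

lemma mon_nonzero [simp]: "mon u \<noteq> 0"
  by (metis keys_mon keys_zero insert_not_empty)

lemma mon_mult: "mon u * mon v = mon (u @ v)"
  by (simp add: mon_def mult_single plus_list_def)

lemma mon_Nil: "mon [] = 1"
  by (simp add: mon_def zero_list_def flip: single_one)

lemma scaleF_eq_mult: "c *\<^sub>F f = Poly_Mapping.single 0 c * f"
  by (simp add: scaleF_def mult_map_scale_conv_mult)

lemma scaleF_mult_left: "(c *\<^sub>F f) * g = c *\<^sub>F (f * g)"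
  by (simp add: scaleF_eq_mult mult.assoc)

lemma linearF_iff: "Vector_Spaces.linear scaleF scaleF L \<longleftrightarrow>
    (\<forall>f g. L (f + g) = L f + L g) \<and> (\<forall>c f. L (c *\<^sub>F f) = c *\<^sub>F L f)"
  by (simp add: Vector_Spaces.linear_iff npoly.vector_space_axioms)

lemma mon_expansion: "f = (\<Sum>u\<in>Poly_Mapping.keys f. Poly_Mapping.lookup f u *\<^sub>F mon u)"
  by (rule poly_mapping_eqI)
    (simp add: lookup_sum lookup_scaleF lookup_mon if_distrib in_keys_iff cong: if_cong)

text \<open>Constants are central: they are supported on the empty word, which is neutral for
  concatenation, so they commute with every word and then, by linearity, with every
  polynomial.\<close>

lemma scaleF_mult_right: "f * (c *\<^sub>F g) = c *\<^sub>F (f * g)"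
proof -
  have mon: "mon u * Poly_Mapping.single 0 c = Poly_Mapping.single 0 c * mon u" for u
    by (simp add: mon_def mult_single)
  have "f * Poly_Mapping.single 0 c = Poly_Mapping.single 0 c * f"
    by (subst (1 2) mon_expansion[of f])
      (simp add: sum_distrib_left sum_distrib_right scaleF_mult_left mon,
        simp add: scaleF_eq_mult mult_single mult.commute flip: mult.assoc)
  then show ?thesis by (simp add: scaleF_eq_mult flip: mult.assoc)
qed

lemma linearF_eqI:
  assumes "Vector_Spaces.linear scaleF scaleF L" "Vector_Spaces.linear scaleF scaleF L'"
    and "\<And>u. u \<in> Poly_Mapping.keys f \<Longrightarrow> L (mon u) = L' (mon u)"
  shows "L f = L' f"
proof -
  have "M f = (\<Sum>u\<in>Poly_Mapping.keys f. Poly_Mapping.lookup f u *\<^sub>F M (mon u))"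
    if "Vector_Spaces.linear scaleF scaleF M" for M
  proof -
    interpret M: Vector_Spaces.linear scaleF scaleF M by fact
    show ?thesis by (subst mon_expansion) (simp add: M.sum M.scale)
  qed
  from this[OF assms(1)] this[OF assms(2)] assms(3) show ?thesis
    by (auto intro!: sum.cong)
qed

lemma linearF_mem:
  assumes "Vector_Spaces.linear scaleF scaleF L" "npoly.subspace S"
    and "\<And>u. u \<in> Poly_Mapping.keys f \<Longrightarrow> L (mon u) \<in> S"
  shows "L f \<in> S"
proof -
  interpret L: Vector_Spaces.linear scaleF scaleF L by fact
  show ?thesis
    using assms(2,3)
    by (subst mon_expansion) (auto simp: L.sum L.scale intro!: npoly.subspace_sum npoly.subspace_scale)
qed

text \<open>Words form a basis, so a linear map may be prescribed on them freely. Normal form,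
  expansion and reduction are all given this way, and identities between them are then checked on
  words only.\<close>

definition linext :: "(word \<Rightarrow> npoly) \<Rightarrow> npoly \<Rightarrow> npoly" where
  "linext h f = (\<Sum>u\<in>Poly_Mapping.keys f. Poly_Mapping.lookup f u *\<^sub>F h u)"

lemma linext_superset:
  "finite A \<Longrightarrow> Poly_Mapping.keys f \<subseteq> A \<Longrightarrow>
    linext h f = (\<Sum>u\<in>A. Poly_Mapping.lookup f u *\<^sub>F h u)"
  unfolding linext_def by (rule sum.mono_neutral_left) (auto simp: in_keys_iff)

lemma linear_linext: "Vector_Spaces.linear scaleF scaleF (linext h)"
  unfolding linearF_iff
proof safe
  fix f g :: npoly and c :: complex
  let ?A = "Poly_Mapping.keys f \<union> Poly_Mapping.keys g"
  have "linext h (f + g) = (\<Sum>u\<in>?A. Poly_Mapping.lookup (f + g) u *\<^sub>F h u)"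
    by (rule linext_superset) (use Poly_Mapping.keys_add[of f g] in auto)
  also have "\<dots> = linext h f + linext h g"
    by (simp add: linext_superset[of ?A] lookup_add npoly.scale_left_distrib sum.distrib)
  finally show "linext h (f + g) = linext h f + linext h g" .
  have "linext h (c *\<^sub>F f) =
      (\<Sum>u\<in>Poly_Mapping.keys f. Poly_Mapping.lookup (c *\<^sub>F f) u *\<^sub>F h u)"
    by (rule linext_superset) (auto simp: in_keys_iff lookup_scaleF)
  then show "linext h (c *\<^sub>F f) = c *\<^sub>F linext h f"
    by (simp add: linext_def lookup_scaleF npoly.scale_sum_right)
qed

lemma linext_mon [simp]: "linext h (mon u) = h u"
  by (simp add: linext_def lookup_mon)

interpretation linext: Vector_Spaces.linear scaleF scaleF "linext h" for h
  by (rule linear_linext)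

lemma linear_compF:
  "Vector_Spaces.linear scaleF scaleF L \<Longrightarrow> Vector_Spaces.linear scaleF scaleF M \<Longrightarrow>
    Vector_Spaces.linear scaleF scaleF (\<lambda>f. L (M f))"
  by (simp add: linearF_iff)

lemma linear_idF: "Vector_Spaces.linear scaleF scaleF (\<lambda>f. f)"
  by (simp add: linearF_iff)

lemma bilinear_eqI:
  fixes B B' :: "npoly \<Rightarrow> npoly \<Rightarrow> npoly"
  assumes "\<And>f. Vector_Spaces.linear scaleF scaleF (B f)" "\<And>g. Vector_Spaces.linear scaleF scaleF (\<lambda>f. B f g)"
    and "\<And>f. Vector_Spaces.linear scaleF scaleF (B' f)" "\<And>g. Vector_Spaces.linear scaleF scaleF (\<lambda>f. B' f g)"
    and "\<And>u v. B (mon u) (mon v) = B' (mon u) (mon v)"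
  shows "B f g = B' f g"
  using assms linearF_eqI[of "\<lambda>f. B f g" "\<lambda>f. B' f g" f] linearF_eqI[of "B _" "B' _" g] by blast

section \<open>Ideals of the free algebra\<close>

lemma free_algebra_simps [simp]:
  "monoid.mult (free_algebra n) = (*)" "one (free_algebra n) = 1"
  "zero (free_algebra n) = 0" "add (free_algebra n) = (+)"
  by (simp_all add: free_algebra_def)

lemma carrier_free_algebra:
  "f \<in> carrier (free_algebra n) \<longleftrightarrow> (\<forall>u\<in>Poly_Mapping.keys f. set u \<subseteq> {..n})"
  by (simp add: free_algebra_def)

interpretation fa: ring "free_algebra n" for n
  by (rule ring_free_algebra)

lemma keys_scaleF: "Poly_Mapping.keys (c *\<^sub>F f) \<subseteq> Poly_Mapping.keys f"
  by (auto simp: in_keys_iff lookup_scaleF)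

lemma subspace_keys: "npoly.subspace {f. \<forall>u\<in>Poly_Mapping.keys f. P u}"
  unfolding npoly.subspace_def using Poly_Mapping.keys_add keys_scaleF by fastforce

lemma subspace_carrier: "npoly.subspace (carrier (free_algebra n))"
  using subspace_keys[of "\<lambda>u. set u \<subseteq> {..n}"] by (simp add: free_algebra_def)

lemma subspace_homogeneous: "npoly.subspace (homogeneous n k)"
proof -
  have "homogeneous n k = {f. \<forall>u\<in>Poly_Mapping.keys f. set u \<subseteq> {..n} \<and> length u = k}"
    by (auto simp: homogeneous_def carrier_free_algebra)
  then show ?thesis by (simp add: subspace_keys)
qed

lemma mon_carrier [simp]: "mon u \<in> carrier (free_algebra n) \<longleftrightarrow> set u \<subseteq> {..n}"
  by (simp add: carrier_free_algebra)

lemma mon_homogeneous [simp]: "mon u \<in> homogeneous n k \<longleftrightarrow> set u \<subseteq> {..n} \<and> length u = k"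
  by (simp add: homogeneous_def)

lemma scaleF_1_carrier: "c *\<^sub>F 1 \<in> carrier (free_algebra n)"
  using npoly.subspace_scale[OF subspace_carrier, of 1 n c] by (simp add: mon_Nil[symmetric])

lemma free_algebra_uminus [simp]: "f \<in> carrier (free_algebra n) \<Longrightarrow> \<ominus>\<^bsub>free_algebra n\<^esub> f = - f"
  by (rule fa.minus_equality[symmetric, THEN sym])
    (use npoly.subspace_neg[OF subspace_carrier] in auto)

lemma free_algebra_minus [simp]:
  "f \<in> carrier (free_algebra n) \<Longrightarrow> g \<in> carrier (free_algebra n) \<Longrightarrow> f \<ominus>\<^bsub>free_algebra n\<^esub> g = f - g"
  by (simp add: a_minus_def)

text \<open>A scalar multiple is a product with the constant \<open>c *\<^sub>F 1\<close>, which
  lies in the carrier. Ring ideals can therefore be handled by linear algebra.\<close>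

lemma ideal_subspace:
  assumes "ideal I (free_algebra n)"
  shows "npoly.subspace I"
proof -
  interpret I: ideal I "free_algebra n" by fact
  have "c *\<^sub>F f \<in> I" if "f \<in> I" for c f
    using I.I_l_closed[OF that scaleF_1_carrier[of c]] by (simp add: scaleF_mult_left)
  with I.zero_closed I.a_closed show ?thesis
    by (simp add: npoly.subspace_def)
qed

lemma idealI_subspace:
  assumes "npoly.subspace I" "I \<subseteq> carrier (free_algebra n)"
    and "\<And>f g. f \<in> I \<Longrightarrow> g \<in> carrier (free_algebra n) \<Longrightarrow> g * f \<in> I \<and> f * g \<in> I"
  shows "ideal I (free_algebra n)"
proof (rule idealI)
  show "subgroup I (add_monoid (free_algebra n))"
  proof (rule subgroup.intro)
    show "inv\<^bsub>add_monoid (free_algebra n)\<^esub> x \<in> I" if "x \<in> I" for x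
      using that assms npoly.subspace_neg[of I x] free_algebra_uminus[of x n]
      by (auto simp: a_inv_def)
  qed (use assms in \<open>auto simp: npoly.subspace_def\<close>)
qed (use assms in \<open>auto simp: ring_free_algebra\<close>)

lemma ideal_mult_mon:
  assumes "ideal I (free_algebra n)" "f \<in> I" "set u \<subseteq> {..n}"
  shows "mon u * f \<in> I" "f * mon u \<in> I"
  using ideal.I_l_closed[OF assms(1,2), of "mon u"] ideal.I_r_closed[OF assms(1,2), of "mon u"] assms(3)
  by simp_all

text \<open>This chains rewriting steps modulo an ideal: the scalars produced by successive steps
  multiply.\<close>

lemma ideal_cong_trans:
  assumes "ideal I (free_algebra n)" "f - c *\<^sub>F g \<in> I" "g - c' *\<^sub>F h \<in> I"
  shows "f - (c * c') *\<^sub>F h \<in> I"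
  using npoly.subspace_add[OF ideal_subspace[OF assms(1)] assms(2)
      npoly.subspace_scale[OF ideal_subspace[OF assms(1)] assms(3), of c]]
  by (simp add: npoly.scale_right_diff_distrib)

section \<open>Leading monomials\<close>

lemma LM_ge: "u \<in> Poly_Mapping.keys f \<Longrightarrow> u \<le> LM f"
  by (simp add: LM_def)

lemma LM_in_keys: "f \<noteq> 0 \<Longrightarrow> LM f \<in> Poly_Mapping.keys f"
  by (simp add: LM_def)

lemma LM_binomial:
  assumes "v < u"
  shows "LM (mon u - c *\<^sub>F mon v) = u"
  unfolding LM_def
proof (rule Max_eqI)
  show "u \<in> Poly_Mapping.keys (mon u - c *\<^sub>F mon v)"
    using less_imp_neq[OF assms] by (simp add: in_keys_iff lookup_minus lookup_scaleF lookup_mon)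
  show "x \<le> u" if "x \<in> Poly_Mapping.keys (mon u - c *\<^sub>F mon v)" for x
    using that assms by (auto simp: in_keys_iff lookup_minus lookup_scaleF lookup_mon split: if_splits)
qed simp

lemma binomial_nonzero:
  assumes "v < u"
  shows "mon u - c *\<^sub>F mon v \<noteq> 0"
proof
  assume "mon u - c *\<^sub>F mon v = 0"
  then have "Poly_Mapping.lookup (mon u - c *\<^sub>F mon v) u = 0" by simp
  with less_imp_neq[OF assms] show False by (simp add: lookup_minus lookup_scaleF lookup_mon)
qed

text \<open>In a vanishing combination, take the element of largest leading monomial among those
  with nonzero coefficient. Its leading monomial occurs in no other such element, so nothing can
  cancel it.\<close>

lemma independent_distinct_LM:
  assumes "0 \<notin> B" "inj_on LM B"
  shows "npoly.independent B"
  unfolding npoly.dependent_explicit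
proof safe
  fix T f g assume T: "finite T" "T \<subseteq> B" "(\<Sum>v\<in>T. f v *\<^sub>F v) = 0" and g: "g \<in> T" "f g \<noteq> 0"
  define S where "S = {v \<in> T. f v \<noteq> 0}"
  have "finite S" "S \<noteq> {}" "S \<subseteq> B" using T g by (auto simp: S_def)
  then have "Max (LM ` S) \<in> LM ` S" "\<forall>v\<in>S. LM v \<le> Max (LM ` S)" by simp_all
  then obtain h where h: "h \<in> S" and max: "\<And>v. v \<in> S \<Longrightarrow> LM v \<le> LM h" by force
  have h0: "h \<noteq> 0" using h \<open>S \<subseteq> B\<close> assms(1) by auto
  \<comment> \<open>If \<open>v\<close> contains \<open>LM h\<close>, then \<open>LM v\<close> is at
    least \<open>LM h\<close>; maximality makes them equal and injectivity of \<open>LM\<close>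
    identifies the elements.\<close>
  have "v = h" if "v \<in> S" "LM h \<in> Poly_Mapping.keys v" for v
    using max[OF that(1)] LM_ge[OF that(2)] assms(2) \<open>S \<subseteq> B\<close> h that(1) by (auto dest: inj_onD)
  then have "f v * Poly_Mapping.lookup v (LM h) = 0" if "v \<in> T - {h}" for v
    using that by (auto simp: S_def in_keys_iff)
  then have "(\<Sum>v\<in>T. f v * Poly_Mapping.lookup v (LM h)) = (\<Sum>v\<in>{h}. f v * Poly_Mapping.lookup v (LM h))"
    using T(1) h by (intro sum.mono_neutral_right) (auto simp: S_def)
  moreover have "(\<Sum>v\<in>T. f v * Poly_Mapping.lookup v (LM h)) = Poly_Mapping.lookup (\<Sum>v\<in>T. f v *\<^sub>F v) (LM h)"
    by (simp add: lookup_sum lookup_scaleF)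
  ultimately have "f h * Poly_Mapping.lookup h (LM h) = 0" using T(3) by simp
  with LM_in_keys[OF h0] h show False by (simp add: S_def in_keys_iff)
qed

section \<open>Normal forms in quantum spaces\<close>

text \<open>This is the factor picked up when the letter \<open>a\<close> is carried to the right
  past every smaller letter of \<open>u\<close>: each exchange of \<open>a\<close> with
  \<open>b < a\<close> contributes \<open>q a b\<close>.\<close>

definition letter_cross :: "(nat \<Rightarrow> nat \<Rightarrow> complex) \<Rightarrow> nat \<Rightarrow> word \<Rightarrow> complex" where
  "letter_cross q a u = prod_list (map (\<lambda>b. if b < a then q a b else 1) u)"

definition word_cross :: "(nat \<Rightarrow> nat \<Rightarrow> complex) \<Rightarrow> word \<Rightarrow> word \<Rightarrow> complex" where
  "word_cross q u v = prod_list (map (\<lambda>a. letter_cross q a v) u)"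

fun inv_weight :: "(nat \<Rightarrow> nat \<Rightarrow> complex) \<Rightarrow> word \<Rightarrow> complex" where
  "inv_weight q [] = 1"
| "inv_weight q (a # u) = letter_cross q a u * inv_weight q u"

definition nform :: "(nat \<Rightarrow> nat \<Rightarrow> complex) \<Rightarrow> npoly \<Rightarrow> npoly" where
  "nform q = linext (\<lambda>u. inv_weight q u *\<^sub>F mon (sort u))"

lemma letter_cross_simps [simp]:
  "letter_cross q a [] = 1"
  "letter_cross q a (b # u) = (if b < a then q a b else 1) * letter_cross q a u"
  "letter_cross q a (u @ v) = letter_cross q a u * letter_cross q a v"
  by (simp_all add: letter_cross_def)

lemma word_cross_simps [simp]:
  "word_cross q [] v = 1"
  "word_cross q (a # u) v = letter_cross q a v * word_cross q u v"
  by (simp_all add: word_cross_def)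

lemma prod_list_map_mset_cong:
  fixes f :: "'a \<Rightarrow> 'b::comm_monoid_mult"
  assumes "mset u = mset v"
  shows "prod_list (map f u) = prod_list (map f v)"
  using assms by (metis mset_map prod_mset_prod_list)

lemma letter_cross_mset: "mset u = mset v \<Longrightarrow> letter_cross q a u = letter_cross q a v"
  unfolding letter_cross_def by (rule prod_list_map_mset_cong)

lemma word_cross_sort: "word_cross q (sort u) (sort v) = word_cross q u v"
proof -
  have "letter_cross q a (sort v) = letter_cross q a v" for a
    by (rule letter_cross_mset) simp
  then show ?thesis
    unfolding word_cross_def by (simp add: prod_list_map_mset_cong[of "sort u" u])
qed

lemma inv_weight_append: "inv_weight q (u @ v) = inv_weight q u * inv_weight q v * word_cross q u v"
  by (induction u) simp_all

lemma letter_cross_eq_1: "\<forall>b\<in>set u. a \<le> b \<Longrightarrow> letter_cross q a u = 1"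
  by (induction u) auto

lemma inv_weight_sorted: "sorted u \<Longrightarrow> inv_weight q u = 1"
  by (induction u) (auto simp: letter_cross_eq_1)

lemma inv_weight_nonzero:
  assumes "mult_antisym n q" "set u \<subseteq> {..n}"
  shows "inv_weight q u \<noteq> 0"
proof -
  have "q a b \<noteq> 0" if "a \<le> n" "b \<le> n" for a b
    using that assms(1) unfolding mult_antisym_def by blast
  then have "letter_cross q a v \<noteq> 0" if "a \<le> n" "set v \<subseteq> {..n}" for a v
    using that by (induction v) auto
  with assms(2) show ?thesis by (induction u) auto
qed

lemma linear_nform: "Vector_Spaces.linear scaleF scaleF (nform q)"
  unfolding nform_def by (rule linear_linext)

interpretation nform: Vector_Spaces.linear scaleF scaleF "nform q" for q
  by (rule linear_nform)

lemma nform_mon: "nform q (mon u) = inv_weight q u *\<^sub>F mon (sort u)"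
  by (simp add: nform_def)

lemma sort_append_sort [simp]: "sort (sort u @ sort v) = sort (u @ v)" for u :: "'a::linorder list"
  by (rule properties_for_sort) simp_all

text \<open>
  The part of the weight of \<open>u @ v\<close> coming from inversions between \<open>u\<close> and \<open>v\<close> depends only on
  the multidegrees, so normalising the factors first does not change the normal form of a product.
\<close>
lemma nform_mult: "nform q (f * g) = nform q (nform q f * nform q g)"
proof (rule bilinear_eqI[where B = "\<lambda>f g. nform q (f * g)" and B' = "\<lambda>f g. nform q (nform q f * nform q g)"])
  show "nform q (mon u * mon v) = nform q (nform q (mon u) * nform q (mon v))" for u v
    by (simp add: nform_mon mon_mult scaleF_mult_left scaleF_mult_right nform.scale inv_weight_append
        inv_weight_sorted word_cross_sort mult.assoc)
qed (simp_all add: linearF_iff nform.add nform.scale scaleF_mult_left scaleF_mult_right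
    distrib_left distrib_right)

lemma nform_fixed: "\<forall>u\<in>Poly_Mapping.keys f. sorted u \<Longrightarrow> nform q f = f"
  by (rule linearF_eqI[OF linear_nform linear_idF])
    (simp add: nform_mon inv_weight_sorted sorted_sort_id)

lemma nform_in_homogeneous:
  assumes "f \<in> homogeneous n k"
  shows "nform q f \<in> homogeneous n k"
proof (rule linearF_mem[OF linear_nform subspace_homogeneous])
  fix u assume "u \<in> Poly_Mapping.keys f"
  with assms have "mon (sort u) \<in> homogeneous n k"
    by (auto simp: homogeneous_def carrier_free_algebra)
  then show "nform q (mon u) \<in> homogeneous n k"
    unfolding nform_mon by (rule npoly.subspace_scale[OF subspace_homogeneous])
qed

lemma keys_nform:
  assumes "f \<in> carrier (free_algebra n)"
  shows "Poly_Mapping.keys (nform q f) \<subseteq> {u. sorted u \<and> set u \<subseteq> {..n}}"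
proof -
  have "nform q f \<in> {f. \<forall>u\<in>Poly_Mapping.keys f. sorted u \<and> set u \<subseteq> {..n}}"
  proof (rule linearF_mem[OF linear_nform subspace_keys])
    fix u assume "u \<in> Poly_Mapping.keys f"
    then have "set u \<subseteq> {..n}" using assms by (simp add: carrier_free_algebra)
    then have "sorted v \<and> set v \<subseteq> {..n}"
      if "v \<in> Poly_Mapping.keys (inv_weight q u *\<^sub>F mon (sort u))" for v
      using that keys_scaleF[of "inv_weight q u" "mon (sort u)"] by force
    then show "nform q (mon u) \<in> {f. \<forall>u\<in>Poly_Mapping.keys f. sorted u \<and> set u \<subseteq> {..n}}"
      by (simp add: nform_mon)
  qed
  then show ?thesis by auto
qed

lemma nform_in_carrier: "f \<in> carrier (free_algebra n) \<Longrightarrow> nform q f \<in> carrier (free_algebra n)"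
  using keys_nform[of f n q] by (auto simp: carrier_free_algebra)

section \<open>The defining ideal as the kernel of the normal form map\<close>

lemma qrelations_carrier: "qrelations n q \<subseteq> carrier (free_algebra n)"
  by (auto simp: qrelations_def intro!: npoly.subspace_diff npoly.subspace_scale subspace_carrier)

lemma ideal_qideal: "ideal (qideal n q) (free_algebra n)"
  unfolding qideal_def by (rule fa.genideal_ideal[OF qrelations_carrier])

lemma subspace_qideal: "npoly.subspace (qideal n q)"
  by (rule ideal_subspace[OF ideal_qideal])

lemmas qideal_mult = ideal_mult_mon[OF ideal_qideal]
  and qideal_trans = ideal_cong_trans[OF ideal_qideal]

text \<open>One pass of insertion sort: \<open>a\<close> moves right by adjacent exchanges, each an
  instance of a defining relation multiplied by words, and stops at the first letter that is not
  smaller.\<close>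

lemma insort_cong_qideal:
  assumes "sorted v" "set (a # v) \<subseteq> {..n}"
  shows "mon (a # v) - letter_cross q a v *\<^sub>F mon (insort a v) \<in> qideal n q"
  using assms
proof (induction v)
  case Nil
  then show ?case by (simp add: npoly.subspace_0[OF subspace_qideal])
next
  case (Cons b v)
  show ?case
  proof (cases "a \<le> b")
    \<comment> \<open>By sortedness no letter of \<open>b # v\<close> is smaller than
      \<open>a\<close>, so the weight is 1 and insertion changes nothing.\<close>
    case True
    with Cons.prems have "letter_cross q a (b # v) = 1" by (intro letter_cross_eq_1) auto
    with True show ?thesis by (simp add: npoly.subspace_0[OF subspace_qideal] del: letter_cross_simps)
  next
    case False
    have "mon [a, b] - q a b *\<^sub>F mon [b, a] \<in> qideal n q"
      unfolding qideal_def
      by (rule fa.genideal_self[OF qrelations_carrier, THEN subsetD])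
        (use False Cons.prems in \<open>force simp: qrelations_def\<close>)
    from qideal_mult(2)[OF this, of v] Cons.prems
    have 1: "mon (a # b # v) - q a b *\<^sub>F mon (b # a # v) \<in> qideal n q"
      by (simp add: algebra_simps scaleF_mult_left mon_mult)
    from Cons have "mon (a # v) - letter_cross q a v *\<^sub>F mon (insort a v) \<in> qideal n q" by simp
    from qideal_mult(1)[OF this, of "[b]"] Cons.prems
    have 2: "mon (b # a # v) - letter_cross q a v *\<^sub>F mon (b # insort a v) \<in> qideal n q"
      by (simp add: algebra_simps scaleF_mult_right mon_mult)
    from qideal_trans[OF 1 2] False show ?thesis by simp
  qed
qed

text \<open>Insertion sort again: sort the tail, then insert the head. The recursion for
  \<open>inv_weight\<close> records exactly these factors, since the factor of the head depends on
  the tail only as a multiset.\<close>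

lemma sort_cong_qideal:
  "set u \<subseteq> {..n} \<Longrightarrow> mon u - inv_weight q u *\<^sub>F mon (sort u) \<in> qideal n q"
proof (induction u)
  case Nil
  then show ?case by (simp add: npoly.subspace_0[OF subspace_qideal])
next
  case (Cons a u)
  then have "mon u - inv_weight q u *\<^sub>F mon (sort u) \<in> qideal n q" by simp
  from qideal_mult(1)[OF this, of "[a]"] Cons.prems
  have 1: "mon (a # u) - inv_weight q u *\<^sub>F mon (a # sort u) \<in> qideal n q"
    by (simp add: algebra_simps scaleF_mult_right mon_mult)
  have "letter_cross q a (sort u) = letter_cross q a u" by (rule letter_cross_mset) simp
  with qideal_trans[OF 1 insort_cong_qideal[of "sort u" a n q]] Cons.prems
  show ?case by (simp add: mult.commute)
qed

lemma nform_cong_qideal: "f \<in> carrier (free_algebra n) \<Longrightarrow> f - nform q f \<in> qideal n q"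
proof (rule linearF_mem[OF _ subspace_qideal, where L = "\<lambda>f. f - nform q f"])
  show "Vector_Spaces.linear scaleF scaleF (\<lambda>f. f - nform q f)"
    by (simp add: linearF_iff nform.add nform.scale npoly.scale_right_diff_distrib)
qed (simp add: nform_mon sort_cong_qideal carrier_free_algebra)

text \<open>The kernel of \<open>nform\<close> is an ideal because \<open>nform_mult\<close> turns a
  zero factor into a zero product. It contains the relations, hence the ideal generated by them.
  Conversely, \<open>f - nform q f\<close> always lies in that ideal.\<close>

lemma qideal_eq: "qideal n q = {f \<in> carrier (free_algebra n). nform q f = 0}" (is "_ = ?K")
proof
  have "npoly.subspace ?K"
    using subspace_carrier[of n]
    by (auto simp: npoly.subspace_def nform.add nform.scale nform.zero)
  then have "ideal ?K (free_algebra n)"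
  proof (rule idealI_subspace)
    fix f g assume "f \<in> ?K" "g \<in> carrier (free_algebra n)"
    then show "g * f \<in> ?K \<and> f * g \<in> ?K"
      using fa.m_closed[of g n f] fa.m_closed[of f n g] nform_mult[of q g f] nform_mult[of q f g]
      by (simp add: nform.zero)
  qed auto
  moreover have "qrelations n q \<subseteq> ?K"
    using qrelations_carrier[of n q]
    by (auto simp: qrelations_def nform.diff nform.scale nform_mon)
  ultimately show "qideal n q \<subseteq> ?K"
    unfolding qideal_def by (rule fa.genideal_minimal)
  show "?K \<subseteq> qideal n q"
    using nform_cong_qideal[of _ n q] by force
qed

lemma qclass_eq_iff:
  assumes "f \<in> carrier (free_algebra n)" "g \<in> carrier (free_algebra n)"
  shows "qclass n q f = qclass n q g \<longleftrightarrow> nform q f = nform q g"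
proof -
  have "qclass n q f = qclass n q g \<longleftrightarrow> f - g \<in> qideal n q"
    using fa.quotient_eq_iff_same_a_r_cos[OF ideal_qideal assms, of q] assms
    by (simp add: qclass_def)
  also have "\<dots> \<longleftrightarrow> nform q f = nform q g"
    using npoly.subspace_diff[OF subspace_carrier assms] by (simp add: qideal_eq nform.diff)
  finally show ?thesis .
qed

lemma nform_idem: "f \<in> carrier (free_algebra n) \<Longrightarrow> nform q (nform q f) = nform q f"
  using keys_nform[of f n q] by (intro nform_fixed) auto

section \<open>Ordered monomials as sorted words\<close>

lemma mset_Tmon: "mset (Tmon n \<alpha>) = (\<Sum>s\<le>n. replicate_mset (\<alpha> s) s)"
proof -
  have "mset (concat (map (\<lambda>s. replicate (\<alpha> s) s) [0..<m])) = (\<Sum>s<m. replicate_mset (\<alpha> s) s)" for m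
    by (induction m) simp_all
  from this[of "Suc n"] show ?thesis by (simp add: Tmon_def lessThan_Suc_atMost del: upt_Suc)
qed

lemma sorted_Tmon: "sorted (Tmon n \<alpha>)"
proof -
  have "sorted (concat (map (\<lambda>s. replicate (\<alpha> s) s) [0..<m]))" for m
    by (induction m) (auto simp: sorted_append)
  then show ?thesis by (simp only: Tmon_def)
qed

lemma count_mset_Tmon: "count (mset (Tmon n \<alpha>)) s = (if s \<le> n then \<alpha> s else 0)"
  by (simp add: mset_Tmon count_sum)

lemma set_Tmon: "set (Tmon n \<alpha>) \<subseteq> {..n}"
  by (auto simp: Tmon_def)

lemma Tmon_mdeg: "set u \<subseteq> {..n} \<Longrightarrow> Tmon n (mdeg u) = sort u"
proof (rule properties_for_sort[symmetric])
  assume "set u \<subseteq> {..n}"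
  then show "mset (Tmon n (mdeg u)) = mset u"
    by (intro multiset_eqI, simp only: count_mset_Tmon) (auto simp: mdeg_def count_mset count_list_0_iff)
qed (rule sorted_Tmon)

lemma range_Tmon: "range (Tmon n) = {u. sorted u \<and> set u \<subseteq> {..n}}"
proof -
  have "u \<in> range (Tmon n)" if "sorted u" "set u \<subseteq> {..n}" for u
    using Tmon_mdeg[of u n] that by (metis rangeI sorted_sort_id)
  then show ?thesis using set_Tmon sorted_Tmon by blast
qed

lemma ordered_monomials_eq:
  "ordered_monomials n p = {u. sorted u \<and> set u \<subseteq> {..n} \<and> length u = p}"
  using range_Tmon[of n] by (auto simp: ordered_monomials_def)

text \<open>Uniqueness in the definite description comes from \<open>nform\<close> fixing sorted
  words: a candidate \<open>g\<close> equals its own normal form, which is determined by the class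
  of \<open>f\<close>.\<close>

lemma Nor_eq: "f \<in> carrier (free_algebra n) \<Longrightarrow> Nor n q f = nform q f"
  unfolding Nor_def range_Tmon
proof (rule the_equality)
  assume f: "f \<in> carrier (free_algebra n)"
  then show "Poly_Mapping.keys (nform q f) \<subseteq> {u. sorted u \<and> set u \<subseteq> {..n}} \<and>
      qclass n q (nform q f) = qclass n q f"
    using keys_nform nform_in_carrier by (simp add: qclass_eq_iff nform_idem)
  fix g assume g: "Poly_Mapping.keys g \<subseteq> {u. sorted u \<and> set u \<subseteq> {..n}} \<and> qclass n q g = qclass n q f"
  then have "g \<in> carrier (free_algebra n)" by (auto simp: carrier_free_algebra)
  with f g have "nform q g = nform q f" by (simp add: qclass_eq_iff)
  moreover from g have "nform q g = g" by (intro nform_fixed) auto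
  ultimately show "g = nform q f" by simp
qed

lemma Nor_mon: "set u \<subseteq> {..n} \<Longrightarrow> Nor n q (mon u) = inv_weight q u *\<^sub>F mon (sort u)"
  by (simp add: Nor_eq nform_mon)

lemma scaleF_mon_eq_iff: "c *\<^sub>F mon u = c' *\<^sub>F mon v \<longleftrightarrow> c = c' \<and> (c = 0 \<or> u = v)"
  by (auto simp: poly_mapping_eq_iff fun_eq_iff lookup_scaleF lookup_mon)

lemma zeta_eq:
  assumes "mult_antisym n q" "set u \<subseteq> {..n}"
  shows "zeta n q u = inv_weight q u"
  unfolding zeta_def using assms inv_weight_nonzero[OF assms]
  by (intro the_equality) (auto simp: Nor_mon Tmon_mdeg scaleF_mon_eq_iff)

section \<open>The degree-lexicographic order\<close>

text \<open>For words of equal length the order is purely lexicographic, so the first differing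
  block decides. This carries comparisons between index words and their expansions, and from a
  subword to the word around it.\<close>

lemma append_less_append_iff:
  fixes u v x y :: "'a::linorder list"
  assumes "length u = length x" "length v = length y"
  shows "u @ v < x @ y \<longleftrightarrow> u < x \<or> u = x \<and> v < y"
  using assms by (induction u x rule: list_induct2) (auto simp: Cons_less_Cons)

text \<open>The head of the sorted word is the smallest letter available: it is either strictly
  smaller than the head of \<open>u\<close>, which decides, or equal to it and both heads can be
  removed.\<close>

lemma sorted_le_mset:
  fixes s u :: "'a::linorder list"
  assumes "sorted s" "mset s = mset u"
  shows "s \<le> u"
  using assms
proof (induction s arbitrary: u)
  case Nil
  then show ?case by simp
next
  case (Cons a s)
  then obtain b u' where u: "u = b # u'" by (cases u) auto
  have len: "length (a # s) = length u" using Cons.prems(2) by (rule mset_eq_length)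
  have "b \<in> set (a # s)" using Cons.prems(2) u by (metis list.set_intros(1) mset_eq_setD)
  with Cons.prems(1) consider "a < b" | "a = b" by fastforce
  then show ?case
  proof cases
    case 2
    with Cons u have "s \<le> u'" by simp
    with 2 u len show ?thesis by (simp add: Cons_le_Cons)
  qed (use u len in \<open>simp add: Cons_le_Cons\<close>)
qed

lemma replicate_0_le: "replicate (length u) 0 \<le> (u :: nat list)"
  by (induction u) (auto simp: Cons_le_Cons)

lemma le_replicate: "set u \<subseteq> {..n} \<Longrightarrow> u \<le> replicate (length u) (n :: nat)"
  by (induction u) (auto simp: Cons_le_Cons)

section \<open>Ordered monomials\<close>

lemma length_Tmon: "length (Tmon n \<alpha>) = (\<Sum>s\<le>n. \<alpha> s)"
  using arg_cong[OF mset_Tmon[of n \<alpha>], of size] by (simp add: size_multiset_sum)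

text \<open>Exponent vectors are written as lists of length \<open>Suc n\<close>, so that the stars
  and bars count for lists with prescribed sum gives the number of ordered monomials.\<close>

lemma bij_betw_Tmon:
  "bij_betw (\<lambda>l. Tmon n ((!) l)) {l. length l = Suc n \<and> sum_list l = p} (ordered_monomials n p)"
proof (rule bij_betwI')
  have len: "length (Tmon n ((!) l)) = sum_list l" if "length l = Suc n" for l
    using that by (simp add: length_Tmon sum_list_sum_nth atLeast0LessThan lessThan_Suc_atMost)
  fix l assume l: "l \<in> {l. length l = Suc n \<and> sum_list l = p}"
  then show "Tmon n ((!) l) \<in> ordered_monomials n p"
    by (auto simp: ordered_monomials_eq sorted_Tmon len set_Tmon[THEN subsetD] dest: set_Tmon[THEN subsetD])
  fix l' assume l': "l' \<in> {l. length l = Suc n \<and> sum_list l = p}"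
  show "Tmon n ((!) l) = Tmon n ((!) l') \<longleftrightarrow> l = l'"
  proof
    assume eq: "Tmon n ((!) l) = Tmon n ((!) l')"
    show "l = l'"
    proof (rule nth_equalityI)
      fix i assume "i < length l"
      with l show "l ! i = l' ! i"
        using count_mset_Tmon[of n "(!) l" i] count_mset_Tmon[of n "(!) l'" i] eq by simp
    qed (use l l' in simp)
  qed simp
next
  fix u assume u: "u \<in> ordered_monomials n p"
  let ?l = "map (mdeg u) [0..<Suc n]"
  have "(\<Sum>s\<le>n. mdeg u s) = length u"
    using length_Tmon[of n "mdeg u"] u Tmon_mdeg[of u n] by (simp add: ordered_monomials_eq)
  then have "sum_list ?l = p"
    using u by (simp add: interv_sum_list_conv_sum_set_nat atLeast0LessThan lessThan_Suc_atMost
        ordered_monomials_eq del: upt_Suc)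
  moreover have "Tmon n ((!) ?l) = Tmon n (mdeg u)"
    unfolding Tmon_def by (intro arg_cong[of _ _ concat] map_cong) (auto simp del: upt_Suc)
  then have "u = Tmon n ((!) ?l)"
    using u by (simp add: Tmon_mdeg ordered_monomials_eq sorted_sort_id del: upt_Suc)
  ultimately show "\<exists>l\<in>{l. length l = Suc n \<and> sum_list l = p}. u = Tmon n ((!) l)"
    by (intro bexI[of _ ?l]) (simp_all del: upt_Suc)
qed

lemma card_ordered_monomials: "card (ordered_monomials n p) = (n + p) choose p"
  using bij_betw_same_card[OF bij_betw_Tmon[of n p]] card_length_sum_list[of "Suc n" p]
  by (simp add: add.commute)

lemma finite_ordered_monomials [simp]: "finite (ordered_monomials n p)"
proof (rule finite_subset)
  show "ordered_monomials n p \<subseteq> {u. set u \<subseteq> {..n} \<and> length u = p}"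
    by (auto simp: ordered_monomials_eq)
qed (simp add: finite_lists_length_eq)

section \<open>The generators of the Veronese subalgebra\<close>

lemma Suc_Nver: "Suc (Nver n d) = (n + d) choose d"
  by (simp add: Nver_def)

lemma length_sorted_ordered_monomials:
  "length (sorted_list_of_set (ordered_monomials n d)) = Suc (Nver n d)"
  by (simp add: card_ordered_monomials Suc_Nver)

lemma bij_betw_wd: "bij_betw (wd n d) {..Nver n d} (ordered_monomials n d)"
  unfolding wd_def[abs_def]
  by (rule bij_betw_nth) (simp_all add: length_sorted_ordered_monomials lessThan_Suc_atMost
      del: length_sorted_list_of_set)

lemma strict_mono_wd: "strict_mono_on {..Nver n d} (wd n d)"
  by (auto simp: strict_mono_on_def wd_def length_sorted_ordered_monomials
      simp del: length_sorted_list_of_set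
      intro!: sorted_wrt_nth_less[OF strict_sorted_list_of_set])

text \<open>The pair (i', j') of the relations as a function of (a, b). For indices up to
  \<open>Nver n d\<close> the description is proper: a sorted word of length \<open>2 * d\<close>
  can be cut in the middle into two generators, in only one way.\<close>

definition nf_pair :: "nat \<Rightarrow> nat \<Rightarrow> nat \<Rightarrow> nat \<Rightarrow> nat \<times> nat" where
  "nf_pair n d a b =
     (THE p. p \<in> Cpairs n d \<and> wd n d (fst p) @ wd n d (snd p) = sort (wd n d a @ wd n d b))"

text \<open>One formula covers both families of relations. On pairs in \<open>Cpairs\<close> it
  gives 0, which lets later arguments treat those pairs uniformly.\<close>

definition nf_rel :: "nat \<Rightarrow> (nat \<Rightarrow> nat \<Rightarrow> complex) \<Rightarrow> nat \<Rightarrow> nat \<times> nat \<Rightarrow> npoly" where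
  "nf_rel n q d = (\<lambda>(a, b). rel a b (fst (nf_pair n d a b)) (snd (nf_pair n d a b)) (phi n q d a b))"

text \<open>The larger index stands first, so that a pair reads like the word of length two that it
  represents.\<close>

definition desc_pairs :: "nat \<Rightarrow> (nat \<times> nat) set" where
  "desc_pairs N = {(j, i). i < j \<and> j \<le> N}"

lemma sum_atMost_choose: "(\<Sum>j\<le>m. j) = Suc m choose 2"
  by (induction m) (simp_all add: numeral_2_eq_2)

lemma card_desc_pairs: "card (desc_pairs m) = Suc m choose 2"
proof -
  have "desc_pairs m = Sigma {..m} lessThan" by (auto simp: desc_pairs_def)
  then show ?thesis by (simp add: sum_atMost_choose)
qed

lemma card_Ppairs: "card (Ppairs n d) = (Nver n d + 2) choose 2"
proof -
  have "Ppairs n d = (\<lambda>(j, i). (i, j)) ` Sigma {..Nver n d} atMost"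
    by (auto simp: Ppairs_def)
  moreover have "inj_on (\<lambda>(j, i). (i, j)) (Sigma {..Nver n d} atMost)" by (auto intro: inj_onI)
  moreover have "(\<Sum>j\<le>m. Suc j) = (m + 2) choose 2" for m
    by (induction m) (simp_all add: numeral_2_eq_2)
  ultimately show ?thesis by (simp add: card_image)
qed

lemma finite_Ppairs [simp]: "finite (Ppairs n d)"
  by (rule finite_subset[of _ "{..Nver n d} \<times> {..Nver n d}"]) (auto simp: Ppairs_def)

lemma finite_Cpairs [simp]: "finite (Cpairs n d)"
  by (rule finite_subset[OF _ finite_Ppairs]) (auto simp: Cpairs_def)

lemma finite_MVpairs [simp]: "finite (MVpairs n d)"
  by (rule finite_subset[OF _ finite_Ppairs]) (auto simp: MVpairs_def)

lemma finite_desc_pairs [simp]: "finite (desc_pairs m)"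
  by (rule finite_subset[of _ "{..m} \<times> {..m}"]) (auto simp: desc_pairs_def)

locale quantum_veronese =
  fixes n d :: nat and q :: "nat \<Rightarrow> nat \<Rightarrow> complex"
  assumes d: "d \<ge> 1" and q: "mult_antisym n q"
begin

abbreviation "N \<equiv> Nver n d"
abbreviation "w \<equiv> wd n d"

lemma w_props:
  assumes "i \<le> N"
  shows "sorted (w i)" "set (w i) \<subseteq> {..n}" "length (w i) = d" "w i \<noteq> []"
proof -
  have "w i \<in> ordered_monomials n d"
    using bij_betw_wd assms by (auto simp: bij_betw_def)
  with d show "sorted (w i)" "set (w i) \<subseteq> {..n}" "length (w i) = d" "w i \<noteq> []"
    by (auto simp: ordered_monomials_eq)
qed

lemma w_surj:
  assumes "sorted u" "set u \<subseteq> {..n}" "length u = d"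
  shows "\<exists>i\<le>N. w i = u"
proof -
  have "u \<in> w ` {..N}"
    using bij_betw_wd[of n d] assms by (simp add: bij_betw_def ordered_monomials_eq)
  then show ?thesis by auto
qed

lemma w_eq_iff: "i \<le> N \<Longrightarrow> j \<le> N \<Longrightarrow> w i = w j \<longleftrightarrow> i = j"
  using bij_betw_wd[of n d] by (auto simp: bij_betw_def inj_on_def)

lemma w_less_iff: "i \<le> N \<Longrightarrow> j \<le> N \<Longrightarrow> w i < w j \<longleftrightarrow> i < j"
  by (rule strict_mono_on_less[OF strict_mono_wd]) auto

lemma w_le_iff: "i \<le> N \<Longrightarrow> j \<le> N \<Longrightarrow> w i \<le> w j \<longleftrightarrow> i \<le> j"
  using w_less_iff[of j i] by (auto simp: not_less[symmetric])

lemma w_0: "w 0 = replicate d 0"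
proof -
  obtain i where i: "i \<le> N" "w i = replicate d 0"
    using w_surj[of "replicate d 0"] d by (auto simp: set_replicate_conv_if)
  have "w i \<le> w 0" using replicate_0_le[of "w 0"] i w_props[of 0] by simp
  with w_le_iff[of i 0] i(1) have "i = 0" by simp
  with i show ?thesis by simp
qed

lemma w_N: "w N = replicate d n"
proof -
  obtain i where i: "i \<le> N" "w i = replicate d n"
    using w_surj[of "replicate d n"] d by (auto simp: set_replicate_conv_if)
  have "w N \<le> w i" using le_replicate[of "w N" n] i w_props[of N] by simp
  with w_le_iff[of N i] i(1) have "i = N" by simp
  with i show ?thesis by simp
qed

lemma last_le_first_iff:
  assumes "a \<le> N" "b \<le> N"
  shows "mlast n d a \<le> mfirst n d b \<longleftrightarrow> sorted (w a @ w b)"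
  using w_props[OF assms(1)] w_props[OF assms(2)]
  by (auto simp: mlast_def mfirst_def sorted_append)

text \<open>Sortedness forces \<open>a \<le> b\<close>: the sorted word \<open>w a @ w b\<close> is
  the least of its rearrangements, hence at most \<open>w b @ w a\<close>, and since the blocks have
  equal length this gives \<open>w a \<le> w b\<close>.\<close>

lemma Cpairs_iff: "(a, b) \<in> Cpairs n d \<longleftrightarrow> a \<le> N \<and> b \<le> N \<and> sorted (w a @ w b)"
proof -
  have "a \<le> b" if "a \<le> N" "b \<le> N" "sorted (w a @ w b)"
  proof -
    have "w a @ w b \<le> w b @ w a" using that(3) by (intro sorted_le_mset) auto
    with that show ?thesis
      using append_less_append_iff[of "w a" "w b" "w b" "w a"]
      by (auto simp: order_le_less w_props w_less_iff w_eq_iff)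
  qed
  then show ?thesis by (auto simp: Cpairs_def Ppairs_def last_le_first_iff)
qed

lemma MVpairs_iff: "(a, b) \<in> MVpairs n d \<longleftrightarrow> a \<le> b \<and> b \<le> N \<and> \<not> sorted (w a @ w b)"
  using last_le_first_iff[of a b] by (auto simp: MVpairs_def Ppairs_def not_le[symmetric])

lemma Cpairs_inj:
  "p \<in> Cpairs n d \<Longrightarrow> p' \<in> Cpairs n d \<Longrightarrow> w (fst p) @ w (snd p) = w (fst p') @ w (snd p') \<Longrightarrow> p = p'"
  by (cases p; cases p') (auto simp: Cpairs_iff w_props w_eq_iff)

lemma Cpairs_split:
  assumes "sorted u" "set u \<subseteq> {..n}" "length u = 2 * d"
  shows "\<exists>p\<in>Cpairs n d. w (fst p) @ w (snd p) = u"
proof -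
  obtain i where i: "i \<le> N" "w i = take d u"
    using w_surj[of "take d u"] assms by (auto simp: sorted_wrt_take dest: in_set_takeD)
  obtain j where j: "j \<le> N" "w j = drop d u"
    using w_surj[of "drop d u"] assms by (auto simp: sorted_wrt_drop dest: in_set_dropD)
  from i j assms show ?thesis by (intro bexI[of _ "(i, j)"]) (auto simp: Cpairs_iff)
qed

text \<open>Concatenation is a bijection onto the ordered monomials of length \<open>2 * d\<close>,
  with inverse given by cutting in the middle.\<close>

lemma card_Cpairs: "card (Cpairs n d) = (n + 2 * d) choose n"
proof -
  have "bij_betw (\<lambda>p. w (fst p) @ w (snd p)) (Cpairs n d) (ordered_monomials n (2 * d))"
  proof (rule bij_betwI')
    fix u assume "u \<in> ordered_monomials n (2 * d)"
    then show "\<exists>p\<in>Cpairs n d. u = w (fst p) @ w (snd p)"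
      using Cpairs_split[of u] by (auto simp: ordered_monomials_eq)
  qed (use Cpairs_inj in \<open>auto simp: Cpairs_iff ordered_monomials_eq w_props
      dest: w_props(2)[THEN subsetD]\<close>)
  from bij_betw_same_card[OF this] show ?thesis
    by (simp add: card_ordered_monomials binomial_symmetric[of n "n + 2 * d"])
qed

lemma Ppairs_split: "Ppairs n d = Cpairs n d \<union> MVpairs n d" "Cpairs n d \<inter> MVpairs n d = {}"
  by (auto simp: Cpairs_def MVpairs_def)

lemma card_MVpairs: "int (card (MVpairs n d)) = int ((N + 2) choose 2) - int ((n + 2 * d) choose n)"
  using card_Un_disjoint[OF finite_Cpairs finite_MVpairs Ppairs_split(2)]
  by (simp add: Ppairs_split(1)[symmetric] card_Ppairs card_Cpairs)

section \<open>Normal pairs and the relations attached to them\<close>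

lemma nf_pair:
  assumes "a \<le> N" "b \<le> N"
  shows "nf_pair n d a b \<in> Cpairs n d"
    and "w (fst (nf_pair n d a b)) @ w (snd (nf_pair n d a b)) = sort (w a @ w b)"
proof -
  have "\<exists>p\<in>Cpairs n d. w (fst p) @ w (snd p) = sort (w a @ w b)"
    by (rule Cpairs_split) (use w_props[OF assms(1)] w_props[OF assms(2)] in auto)
  then have "\<exists>!p. p \<in> Cpairs n d \<and> w (fst p) @ w (snd p) = sort (w a @ w b)"
    using Cpairs_inj by metis
  from theI'[OF this] show "nf_pair n d a b \<in> Cpairs n d"
    "w (fst (nf_pair n d a b)) @ w (snd (nf_pair n d a b)) = sort (w a @ w b)"
    by (simp_all add: nf_pair_def)
qed

lemma nf_pair_eqI:
  "a \<le> N \<Longrightarrow> b \<le> N \<Longrightarrow> (i, j) \<in> Cpairs n d \<Longrightarrow> w i @ w j = sort (w a @ w b) \<Longrightarrow> nf_pair n d a b = (i, j)"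
  using Cpairs_inj[of "nf_pair n d a b" "(i, j)"] nf_pair[of a b] by simp

lemma phi_eq: "a \<le> N \<Longrightarrow> b \<le> N \<Longrightarrow> phi n q d a b = inv_weight q (w a @ w b)"
  unfolding phi_def using w_props[of a] w_props[of b] by (intro zeta_eq[OF q]) auto

lemma phi_nonzero: "a \<le> N \<Longrightarrow> b \<le> N \<Longrightarrow> phi n q d a b \<noteq> 0"
  using w_props[of a] w_props[of b] by (simp add: phi_eq inv_weight_nonzero[OF q])

lemma phi_Cpairs: "(a, b) \<in> Cpairs n d \<Longrightarrow> phi n q d a b = 1"
  by (simp add: Cpairs_iff phi_eq inv_weight_sorted)

text \<open>The normal form is a nonzero multiple of a single word, so both the word and the scalar
  can be read off; the word then determines the pair.\<close>

lemma normal_pair_iff: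
  assumes "a \<le> N" "b \<le> N"
  shows "normal_pair n q d a b i j c \<longleftrightarrow> (i, j) = nf_pair n d a b \<and> c = phi n q d a b"
proof -
  have *: "set (w a @ w b) \<subseteq> {..n}" using w_props[OF assms(1)] w_props[OF assms(2)] by simp
    have "normal_pair n q d a b i j c \<longleftrightarrow>
        (i, j) \<in> Cpairs n d \<and> w i @ w j = sort (w a @ w b) \<and> c = phi n q d a b"
      unfolding normal_pair_def Nor_mon[OF *] scaleF_mon_eq_iff phi_eq[OF assms, symmetric]
      using phi_nonzero[OF assms] by metis
    also have "\<dots> \<longleftrightarrow> (i, j) = nf_pair n d a b \<and> c = phi n q d a b"
      using nf_pair_eqI[OF assms, of i j] nf_pair[OF assms] by (metis fst_conv snd_conv)
    finally show ?thesis .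
qed

lemma normal_rel_iff:
  assumes "a \<le> N" "b \<le> N"
  shows "(\<exists>i j c. r = rel a b i j c \<and> normal_pair n q d a b i j c) \<longleftrightarrow> r = nf_rel n q d (a, b)"
  by (cases "nf_pair n d a b") (simp add: normal_pair_iff[OF assms] nf_rel_def)

lemma R1_eq: "R1 n q d = nf_rel n q d ` desc_pairs N"
proof (rule Set.set_eqI)
  fix r
  have "r \<in> R1 n q d \<longleftrightarrow>
      (\<exists>i j. i < j \<and> j \<le> N \<and> (\<exists>i' j' c. r = rel j i i' j' c \<and> normal_pair n q d j i i' j' c))"
    unfolding R1_def mem_Collect_eq by blast
  also have "\<dots> \<longleftrightarrow> (\<exists>i j. i < j \<and> j \<le> N \<and> r = nf_rel n q d (j, i))"
    using normal_rel_iff by (metis less_le_trans less_imp_le)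
  finally show "r \<in> R1 n q d \<longleftrightarrow> r \<in> nf_rel n q d ` desc_pairs N"
    by (auto simp: desc_pairs_def)
qed

lemma R2_eq: "R2 n q d = nf_rel n q d ` MVpairs n d"
proof (rule Set.set_eqI)
  fix r
  have "r \<in> R2 n q d \<longleftrightarrow>
      (\<exists>i j. (i, j) \<in> MVpairs n d \<and> (\<exists>i' j' c. r = rel i j i' j' c \<and> normal_pair n q d i j i' j' c))"
    unfolding R2_def mem_Collect_eq by blast
  also have "\<dots> \<longleftrightarrow> (\<exists>i j. (i, j) \<in> MVpairs n d \<and> r = nf_rel n q d (i, j))"
    using normal_rel_iff MVpairs_iff by (metis le_trans)
  finally show "r \<in> R2 n q d \<longleftrightarrow> r \<in> nf_rel n q d ` MVpairs n d"
    by auto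
qed

lemma not_sorted_desc:
  assumes "i < j" "j \<le> N"
  shows "\<not> sorted (w j @ w i)"
  using Cpairs_iff[of j i] assms by (auto simp: Cpairs_def Ppairs_def)

definition "red_pairs = desc_pairs N \<union> MVpairs n d"

lemma red_pairs_iff: "(a, b) \<in> red_pairs \<longleftrightarrow> a \<le> N \<and> b \<le> N \<and> (a, b) \<notin> Cpairs n d"
  using not_sorted_desc[of b a] by (auto simp: red_pairs_def desc_pairs_def MVpairs_iff Cpairs_iff)

lemma finite_red_pairs: "finite red_pairs"
  by (simp add: red_pairs_def)

lemma desc_MV_disjoint: "desc_pairs N \<inter> MVpairs n d = {}"
  by (auto simp: desc_pairs_def MVpairs_iff)

text \<open>An unsorted word is strictly larger than its sorted rearrangement. The first inequality
  gives leading monomials after expansion; the second gives leading monomials and termination in the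
  free algebra on the generators.\<close>

lemma nf_pair_less:
  assumes "(a, b) \<in> red_pairs" "nf_pair n d a b = (i, j)"
  shows "w i @ w j < w a @ w b" "[i, j] < [a, b]"
proof -
  from assms(1) have ab: "a \<le> N" "b \<le> N" "\<not> sorted (w a @ w b)"
    by (auto simp: red_pairs_iff Cpairs_iff)
  from nf_pair[OF ab(1,2)] assms(2) have ij: "i \<le> N" "j \<le> N" "w i @ w j = sort (w a @ w b)"
    by (auto simp: Cpairs_iff)
  have "w i @ w j \<le> w a @ w b" unfolding ij(3) by (rule sorted_le_mset) simp_all
  moreover have "w i @ w j \<noteq> w a @ w b" using ij(3) ab(3) by (metis sorted_sort)
  ultimately show less: "w i @ w j < w a @ w b" by simp
  have "w i < w a \<or> w i = w a \<and> w j < w b"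
    using less append_less_append_iff[of "w i" "w a" "w j" "w b"] ab(1,2) ij(1,2) by (simp add: w_props)
  then show "[i, j] < [a, b]"
    using ab(1,2) ij(1,2) by (simp add: w_less_iff w_eq_iff Cons_less_Cons)
qed

lemma nf_rel_eq: "nf_rel n q d (a, b) =
    mon [a, b] - phi n q d a b *\<^sub>F mon [fst (nf_pair n d a b), snd (nf_pair n d a b)]"
  by (simp add: nf_rel_def rel_def)

lemma LM_nf_rel: "p \<in> red_pairs \<Longrightarrow> LM (nf_rel n q d p) = [fst p, snd p]"
  using nf_pair_less(2)[of "fst p" "snd p"] LM_binomial
  by (cases p) (simp add: nf_rel_eq)

lemma nf_rel_nonzero: "p \<in> red_pairs \<Longrightarrow> nf_rel n q d p \<noteq> 0"
  using nf_pair_less(2)[of "fst p" "snd p"] binomial_nonzero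
  by (cases p) (simp add: nf_rel_eq)

text \<open>The trailing word of each relation comes from \<open>Cpairs\<close>, so a reducible word
  can occur only as the leading word of its own relation.\<close>

lemma in_keys_nf_rel:
  assumes "(a, b) \<in> red_pairs" "(a', b') \<in> red_pairs"
  shows "[a', b'] \<in> Poly_Mapping.keys (nf_rel n q d (a, b)) \<longleftrightarrow> (a, b) = (a', b')"
proof -
  have "(a', b') \<noteq> nf_pair n d a b"
    using nf_pair(1)[of a b] assms by (auto simp: red_pairs_iff)
  moreover have "(a, b) \<noteq> nf_pair n d a b"
    using nf_pair(1)[of a b] assms by (auto simp: red_pairs_iff)
  ultimately show ?thesis
    by (cases "nf_pair n d a b") (auto simp: nf_rel_eq in_keys_iff lookup_minus lookup_scaleF lookup_mon)
qed

lemma inj_nf_rel: "inj_on (nf_rel n q d) red_pairs"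
proof (rule inj_onI)
  fix p p' assume "p \<in> red_pairs" "p' \<in> red_pairs" "nf_rel n q d p = nf_rel n q d p'"
  then show "p = p'" using LM_nf_rel[of p] LM_nf_rel[of p'] by (auto simp: prod_eq_iff)
qed

end

section \<open>The kernel of the Veronese map\<close>

lemma expand_eq: "expand n d = linext (\<lambda>u. mon (concat (map (wd n d) u)))"
  by (simp add: expand_def linext_def fun_eq_iff)

interpretation expand: Vector_Spaces.linear scaleF scaleF "expand n d" for n d
  unfolding expand_eq by (rule linear_linext)

lemma expand_mon [simp]: "expand n d (mon u) = mon (concat (map (wd n d) u))"
  by (simp add: expand_eq)

lemma expand_mult: "expand n d (f * g) = expand n d f * expand n d g"
  by (rule bilinear_eqI[where B = "\<lambda>f g. expand n d (f * g)" and B' = "\<lambda>f g. expand n d f * expand n d g"])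
    (simp_all add: linearF_iff expand.add expand.scale scaleF_mult_left scaleF_mult_right
      distrib_left distrib_right mon_mult)

lemma expand_1: "expand n d 1 = 1"
  using expand_mon[of n d "[]"] by (simp add: mon_Nil)

interpretation qspace: ring "qspace n q" for n q
  unfolding qspace_def by (rule ideal.quotient_is_ring[OF ideal_qideal])

lemma qclass_hom: "qclass n q \<in> ring_hom (free_algebra n) (qspace n q)"
  using ideal.rcos_ring_hom[OF ideal_qideal[of n q]] by (simp add: qclass_def[abs_def] qspace_def)

context quantum_veronese
begin

lemma set_concat_w: "set u \<subseteq> {..N} \<Longrightarrow> set (concat (map w u)) \<subseteq> {..n}"
  using w_props(2) by fastforce

lemma length_concat_w: "set u \<subseteq> {..N} \<Longrightarrow> length (concat (map w u)) = length u * d"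
  by (induction u) (simp_all add: w_props)

text \<open>All blocks have the same positive length, so they can be read off one at a time;
  positivity excludes a nonempty word with empty expansion.\<close>

lemma concat_w_inj:
  "set u \<subseteq> {..N} \<Longrightarrow> set v \<subseteq> {..N} \<Longrightarrow> concat (map w u) = concat (map w v) \<Longrightarrow> u = v"
proof (induction u arbitrary: v)
  case Nil
  then show ?case using w_props(4) by (cases v) auto
next
  case (Cons a u)
  then obtain b v' where v: "v = b # v'" using w_props(4)[of a] by (cases v) auto
  with Cons.prems have eq: "w a = w b" "concat (map w u) = concat (map w v')" by (simp_all add: w_props)
  have "a = b" using eq(1) w_eq_iff[of a b] Cons.prems v by simp
  moreover have "u = v'" using Cons.IH[OF _ _ eq(2)] Cons.prems v by simp
  ultimately show ?case using v by simp
qed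

lemma expand_carrier: "f \<in> carrier (free_algebra N) \<Longrightarrow> expand n d f \<in> carrier (free_algebra n)"
  by (rule linearF_mem[OF expand.linear_axioms subspace_carrier])
    (simp add: set_concat_w carrier_free_algebra del: set_concat)

lemma expand_homogeneous: "f \<in> homogeneous N k \<Longrightarrow> expand n d f \<in> homogeneous n (k * d)"
  by (rule linearF_mem[OF expand.linear_axioms subspace_homogeneous])
    (simp add: set_concat_w length_concat_w homogeneous_def carrier_free_algebra del: set_concat)

lemma veronese_map_hom: "veronese_map n q d \<in> ring_hom (free_algebra N) (qspace n q)"
proof -
  have "expand n d \<in> ring_hom (free_algebra N) (free_algebra n)"
    by (rule ring_hom_memI) (simp_all add: expand_carrier expand.add expand_mult expand_1)
  from ring_hom_trans[OF this qclass_hom[of n q]] show ?thesis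
    by (simp add: veronese_map_def[abs_def] comp_def)
qed

interpretation vmap: ring_hom_ring "free_algebra N" "qspace n q" "veronese_map n q d"
  by (intro ring_hom_ringI2 ring_free_algebra qspace.ring_axioms veronese_map_hom)

text \<open>Cut the word into blocks of length \<open>d\<close>. Each block of a sorted word is
  sorted and is therefore a generator.\<close>

lemma word_of_sorted:
  assumes "sorted u" "set u \<subseteq> {..n}" "length u = k * d"
  shows "\<exists>v. set v \<subseteq> {..N} \<and> length v = k \<and> concat (map w v) = u"
  using assms
proof (induction k arbitrary: u)
  case 0
  then show ?case by simp
next
  case (Suc k)
  obtain i where i: "i \<le> N" "w i = take d u"
    using w_surj[of "take d u"] Suc.prems by (auto simp: sorted_wrt_take dest: in_set_takeD)
  obtain v where v: "set v \<subseteq> {..N}" "length v = k" "concat (map w v) = drop d u"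
    using Suc.IH[of "drop d u"] Suc.prems by (auto simp: sorted_wrt_drop dest: in_set_dropD)
  from i v show ?case by (intro exI[of _ "i # v"]) simp
qed

lemma veronese_map_eq_iff:
  assumes "f \<in> carrier (free_algebra N)" "g \<in> carrier (free_algebra N)"
  shows "veronese_map n q d f = veronese_map n q d g \<longleftrightarrow> nform q (expand n d f) = nform q (expand n d g)"
  unfolding veronese_map_def using assms by (simp add: qclass_eq_iff expand_carrier)

lemma homogeneous_carrier: "homogeneous m k \<subseteq> carrier (free_algebra m)"
  by (auto simp: homogeneous_def)

lemma veronese_map_homogeneous: "veronese_map n q d ` homogeneous N k = qcomponent n q (k * d)"
proof
  show "veronese_map n q d ` homogeneous N k \<subseteq> qcomponent n q (k * d)"
    by (auto simp: qcomponent_def veronese_map_def expand_homogeneous)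
  show "qcomponent n q (k * d) \<subseteq> veronese_map n q d ` homogeneous N k"
  proof
    fix y assume "y \<in> qcomponent n q (k * d)"
    then obtain h where h: "h \<in> homogeneous n (k * d)" "y = qclass n q h"
      by (auto simp: qcomponent_def)
    then have hc: "h \<in> carrier (free_algebra n)" using homogeneous_carrier by auto
    \<comment> \<open>The words of \<open>h\<close> itself need not split into sorted blocks; those
      of its normal form do, and the class is unchanged.\<close>
    let ?g = "nform q h"
    have keys: "sorted u \<and> set u \<subseteq> {..n} \<and> length u = k * d" if "u \<in> Poly_Mapping.keys ?g" for u
      using that keys_nform[OF hc, of q] nform_in_homogeneous[OF h(1), of q] by (auto simp: homogeneous_def)
    then have "\<forall>u\<in>Poly_Mapping.keys ?g. \<exists>v. set v \<subseteq> {..N} \<and> length v = k \<and> concat (map w v) = u"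
      using word_of_sorted by blast
    then obtain v where v: "\<forall>u\<in>Poly_Mapping.keys ?g.
        set (v u) \<subseteq> {..N} \<and> length (v u) = k \<and> concat (map w (v u)) = u"
      by (rule bchoice[THEN exE])
    define f where "f = linext (\<lambda>u. mon (v u)) ?g"
    have f: "f \<in> homogeneous N k"
      unfolding f_def by (rule linearF_mem[OF linear_linext subspace_homogeneous]) (simp add: v)
    have "expand n d f = ?g"
      unfolding f_def
      by (rule linearF_eqI[OF linear_compF[OF expand.linear_axioms linear_linext] linear_idF])
        (simp add: v)
    then have "veronese_map n q d f = y"
      unfolding veronese_map_def using h(2) hc by (simp add: qclass_eq_iff nform_in_carrier nform_idem)
    with f show "y \<in> veronese_map n q d ` homogeneous N k" by blast
  qed
qed

lemma veronese_map_sum: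
  assumes "finite K" "\<And>k. k \<in> K \<Longrightarrow> g k \<in> carrier (free_algebra N)"
  shows "veronese_map n q d (\<Sum>k\<in>K. g k) = finsum (qspace n q) (\<lambda>k. veronese_map n q d (g k)) K"
  using assms
proof (induction K)
  case empty
  then show ?case using vmap.hom_zero by simp
next
  case (insert k K)
  have "(\<Sum>k\<in>K. g k) \<in> carrier (free_algebra N)"
    using insert.prems by (intro npoly.subspace_sum[OF subspace_carrier]) auto
  then have "veronese_map n q d (g k + (\<Sum>k\<in>K. g k)) =
      veronese_map n q d (g k) \<oplus>\<^bsub>qspace n q\<^esub> veronese_map n q d (\<Sum>k\<in>K. g k)"
    using vmap.hom_add[of "g k" "\<Sum>k\<in>K. g k"] insert.prems by simp
  with insert show ?case by (simp add: qspace.finsum_insert Pi_def)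
qed

lemma veronese_map_image: "veronese_map n q d ` carrier (free_algebra N) = veronese n q d"
proof
  show "veronese_map n q d ` carrier (free_algebra N) \<subseteq> veronese n q d"
  proof clarify
    fix f assume f: "f \<in> carrier (free_algebra N)"
    \<comment> \<open>\<open>f\<close> is decomposed by word length. The lengths that occur form the
      finite index set required by \<open>veronese\<close>.\<close>
    define K where "K = length ` Poly_Mapping.keys f"
    define g where "g k = (\<Sum>u | u \<in> Poly_Mapping.keys f \<and> length u = k. Poly_Mapping.lookup f u *\<^sub>F mon u)" for k
    have g: "g k \<in> homogeneous N k" for k
      unfolding g_def using f
      by (intro npoly.subspace_sum npoly.subspace_scale subspace_homogeneous)
        (auto simp: carrier_free_algebra)
    have "(\<Sum>k\<in>K. g k) = f"
      unfolding g_def K_def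
      by (subst sum.image_gen[where g = length, symmetric]) (simp_all flip: mon_expansion)
    moreover have "finite K" by (simp add: K_def)
    moreover have "veronese_map n q d (g k) \<in> qcomponent n q (k * d)" for k
      using g veronese_map_homogeneous by blast
    moreover have "g k \<in> carrier (free_algebra N)" for k
      using g homogeneous_carrier by blast
    ultimately show "veronese_map n q d f \<in> veronese n q d"
      using veronese_map_sum[of K g] unfolding veronese_def by auto
  qed
  show "veronese n q d \<subseteq> veronese_map n q d ` carrier (free_algebra N)"
  proof
    fix y assume "y \<in> veronese n q d"
    then obtain a K where K: "finite K" "\<And>k. k \<in> K \<Longrightarrow> a k \<in> qcomponent n q (k * d)"
      and y: "y = finsum (qspace n q) a K"
      by (auto simp: veronese_def)
    have "\<forall>k\<in>K. \<exists>g. g \<in> homogeneous N k \<and> veronese_map n q d g = a k"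
      using K(2) unfolding veronese_map_homogeneous[symmetric] by blast
    then obtain g where g: "\<forall>k\<in>K. g k \<in> homogeneous N k \<and> veronese_map n q d (g k) = a k"
      by (rule bchoice[THEN exE])
    then have gc: "g k \<in> carrier (free_algebra N)" if "k \<in> K" for k
      using homogeneous_carrier that by blast
    have "finsum (qspace n q) a K = finsum (qspace n q) (\<lambda>k. veronese_map n q d (g k)) K"
      by (rule qspace.finsum_cong') (use g gc in auto)
    then have "y = veronese_map n q d (\<Sum>k\<in>K. g k)"
      using veronese_map_sum[OF K(1) gc] y by simp
    moreover have "(\<Sum>k\<in>K. g k) \<in> carrier (free_algebra N)"
      by (rule npoly.subspace_sum[OF subspace_carrier gc])
    ultimately show "y \<in> veronese_map n q d ` carrier (free_algebra N)" by blast
  qed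
qed

lemma subring_veronese: "subring (veronese n q d) (qspace n q)"
  using vmap.img_is_subring[OF fa.carrier_is_subring] by (simp only: veronese_map_image)

lemma veronese_map_veronese_ring:
  "veronese_map n q d \<in> ring_hom (free_algebra N) (veronese_ring n q d)"
proof (rule ring_hom_memI)
  show "veronese_map n q d f \<in> carrier (veronese_ring n q d)" if "f \<in> carrier (free_algebra N)" for f
    using imageI[OF that, of "veronese_map n q d"] by (simp add: veronese_map_image veronese_ring_def)
qed (use vmap.hom_mult vmap.hom_add vmap.hom_one in \<open>simp_all add: veronese_ring_def\<close>)

text \<open>The kernel is described through normal forms instead of cosets, so that membership is a
  linear condition in the free algebra.\<close>

definition vkernel :: "npoly set" where
  "vkernel = {f \<in> carrier (free_algebra N). nform q (expand n d f) = 0}"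

lemma a_kernel_eq: "a_kernel (free_algebra N) (veronese_ring n q d) (veronese_map n q d) = vkernel"
proof -
  have zero: "\<zero>\<^bsub>veronese_ring n q d\<^esub> = veronese_map n q d 0"
    using vmap.hom_zero by (simp add: veronese_ring_def)
  have "veronese_map n q d f = veronese_map n q d 0 \<longleftrightarrow> nform q (expand n d f) = 0"
    if "f \<in> carrier (free_algebra N)" for f
    using veronese_map_eq_iff[OF that, of 0] npoly.subspace_0[OF subspace_carrier]
    by (simp add: expand.zero nform.zero)
  then show ?thesis
    unfolding a_kernel_def' zero vkernel_def by blast
qed

lemma subspace_vkernel: "npoly.subspace vkernel"
  using subspace_carrier[of N]
  by (auto simp: vkernel_def npoly.subspace_def expand.zero nform.zero expand.add nform.add
      expand.scale nform.scale)

lemma ideal_vkernel: "ideal vkernel (free_algebra N)"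
proof (rule idealI_subspace[OF subspace_vkernel])
  fix f g assume "f \<in> vkernel" "g \<in> carrier (free_algebra N)"
  then show "g * f \<in> vkernel \<and> f * g \<in> vkernel"
    using fa.m_closed[of g N f] fa.m_closed[of f N g]
      nform_mult[of q "expand n d g" "expand n d f"] nform_mult[of q "expand n d f" "expand n d g"]
    by (simp add: vkernel_def expand_mult nform.zero)
qed (auto simp: vkernel_def)

text \<open>Since blocks are nonempty and each is sorted, sortedness of all adjacent pairs implies
  sortedness of the whole concatenation. Hence any disorder is visible in a reducible subword of
  length two.\<close>

lemma concat_w_not_sorted:
  assumes "set u \<subseteq> {..N}" "\<not> sorted (concat (map w u))"
  shows "\<exists>x a b y. u = x @ [a, b] @ y \<and> \<not> sorted (w a @ w b)"
  using assms
proof (induction u)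
  case Nil
  then show ?case by simp
next
  case (Cons a u)
  show ?case
  proof (cases "sorted (concat (map w u))")
    case False
    with Cons obtain x a' b y where "u = x @ [a', b] @ y" "\<not> sorted (w a' @ w b)" by auto
    then show ?thesis by (intro exI[of _ "a # x"]) auto
  next
    case True
    with Cons.prems w_props(1)[of a] obtain b y where u: "u = b # y" by (cases u) auto
    have "\<not> sorted (w a @ w b)"
    proof
      assume ab: "sorted (w a @ w b)"
      \<comment> \<open>The first letter \<open>c\<close> of \<open>w b\<close> separates the two
        parts: letters of \<open>w a\<close> are at most \<open>c\<close>, and all letters of the
        remaining expansion are at least \<open>c\<close>.\<close>
      obtain c z where "w b = c # z" using w_props(4)[of b] Cons.prems u by (cases "w b") auto
      then have "\<forall>x\<in>set (w a). x \<le> c" "\<forall>y\<in>set (concat (map w u)). c \<le> y"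
        using ab True u by (auto simp: sorted_append)
      then have "sorted (w a @ concat (map w u))"
        using True ab unfolding sorted_append by (meson order_trans)
      with Cons.prems show False by simp
    qed
    with u show ?thesis by (intro exI[of _ "[]"]) auto
  qed
qed

section \<open>Rewriting in the free algebra on the generators\<close>

definition normal_word :: "word \<Rightarrow> bool" where
  "normal_word u \<longleftrightarrow> set u \<subseteq> {..N} \<and> sorted (concat (map w u))"

text \<open>Well-founded induction along the degree-lexicographic order: a word that is not normal
  has a reducible subword, and replacing it gives a smaller word. Because the relations are
  binomial, one word with one scalar remains at every stage.\<close>

lemma reduce_word:
  assumes I: "ideal I (free_algebra N)" and rel: "\<And>p. p \<in> red_pairs \<Longrightarrow> nf_rel n q d p \<in> I"
  shows "set u \<subseteq> {..N} \<Longrightarrow> \<exists>v c. normal_word v \<and> mon u - c *\<^sub>F mon v \<in> I"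
proof (induction u rule: less_induct)
  case (less u)
  show ?case
  proof (cases "sorted (concat (map w u))")
    case True
    then show ?thesis
      using less.prems npoly.subspace_0[OF ideal_subspace[OF I]]
      by (intro exI[of _ u] exI[of _ 1]) (simp add: normal_word_def)
  next
    case False
    from concat_w_not_sorted[OF less.prems False] obtain x a b y
      where u: "u = x @ [a, b] @ y" and "\<not> sorted (w a @ w b)" by blast
    with less.prems have ab: "(a, b) \<in> red_pairs" by (auto simp: red_pairs_iff Cpairs_iff)
    obtain i j where ij: "nf_pair n d a b = (i, j)" by force
    have "(i, j) \<in> Cpairs n d" using nf_pair(1)[of a b] ab ij by (simp add: red_pairs_iff)
    then have set: "set (x @ [i, j] @ y) \<subseteq> {..N}" using less.prems u by (auto simp: Cpairs_iff)
    have "x @ [i, j] @ y < u"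
      using nf_pair_less(2)[OF ab ij] unfolding u by (subst append_less_append_iff, simp, simp, subst append_less_append_iff) simp_all
    from less.IH[OF this set] obtain v c
      where v: "normal_word v" "mon (x @ [i, j] @ y) - c *\<^sub>F mon v \<in> I" by blast
    have "mon x * (nf_rel n q d (a, b) * mon y) \<in> I"
      using less.prems u by (intro ideal_mult_mon[OF I] rel ab) auto
    then have "mon u - phi n q d a b *\<^sub>F mon (x @ [i, j] @ y) \<in> I"
      by (simp add: nf_rel_eq ij u algebra_simps scaleF_mult_left scaleF_mult_right mon_mult)
    from ideal_cong_trans[OF I this v(2)] v(1) show ?thesis by blast
  qed
qed

text \<open>Normal words expand to distinct sorted words, which \<open>nform\<close> fixes. Each
  coefficient of \<open>g\<close> thus reappears unchanged in the normal form of its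
  expansion.\<close>

lemma expand_normal_inj:
  assumes "\<forall>u\<in>Poly_Mapping.keys g. normal_word u" "nform q (expand n d g) = 0"
  shows "g = 0"
proof -
  have "nform q (expand n d g) = expand n d g"
    by (rule linearF_eqI[OF linear_compF[OF linear_nform expand.linear_axioms] expand.linear_axioms])
      (use assms(1) in \<open>simp add: normal_word_def nform_mon inv_weight_sorted sorted_sort_id\<close>)
  with assms(2) have 0: "expand n d g = 0" by simp
  have "Poly_Mapping.lookup g u = 0" if u: "u \<in> Poly_Mapping.keys g" for u
  proof -
    have "Poly_Mapping.lookup (expand n d g) (concat (map w u)) =
        (\<Sum>v\<in>Poly_Mapping.keys g. if v = u then Poly_Mapping.lookup g v else 0)"
      unfolding expand_def lookup_sum lookup_scaleF lookup_mon
      using concat_w_inj[of _ u] u assms(1) by (intro sum.cong) (auto simp: normal_word_def)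
    with u 0 show ?thesis by simp
  qed
  then have "Poly_Mapping.lookup g u = 0" for u by (cases "u \<in> Poly_Mapping.keys g") (auto simp: in_keys_iff)
  then show ?thesis by (intro poly_mapping_eqI) simp
qed

text \<open>For \<open>f\<close> in the kernel, \<open>f - red f\<close> lies in the ideal and hence
  in the kernel, so \<open>red f\<close> does too. As a combination of normal words in the kernel it
  vanishes, leaving \<open>f\<close> in the ideal.\<close>

lemma vkernel_eq_Idl:
  assumes "R \<subseteq> vkernel" and rel: "\<And>p. p \<in> red_pairs \<Longrightarrow> nf_rel n q d p \<in> Idl\<^bsub>free_algebra N\<^esub> R"
  shows "vkernel = Idl\<^bsub>free_algebra N\<^esub> R"
proof
  have R: "R \<subseteq> carrier (free_algebra N)" using assms(1) by (auto simp: vkernel_def)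
  let ?I = "Idl\<^bsub>free_algebra N\<^esub> R"
  note I = fa.genideal_ideal[OF R]
  show IK: "?I \<subseteq> vkernel" by (rule fa.genideal_minimal[OF ideal_vkernel assms(1)])
  \<comment> \<open>A reduction is chosen for each word and then extended linearly. Words outside
    the alphabet get arbitrary values, which are harmless because they do not occur in
    \<open>f\<close>.\<close>
  have "\<forall>u. \<exists>vc. set u \<subseteq> {..N} \<longrightarrow> normal_word (fst vc) \<and> mon u - snd vc *\<^sub>F mon (fst vc) \<in> ?I"
    using reduce_word[OF I rel] by fastforce
  then obtain r where r: "\<And>u. set u \<subseteq> {..N} \<Longrightarrow>
      normal_word (fst (r u)) \<and> mon u - snd (r u) *\<^sub>F mon (fst (r u)) \<in> ?I"
    by metis
  define red where "red = linext (\<lambda>u. snd (r u) *\<^sub>F mon (fst (r u)))"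
  show "vkernel \<subseteq> ?I"
  proof
    fix f assume f: "f \<in> vkernel"
    then have keys: "set u \<subseteq> {..N}" if "u \<in> Poly_Mapping.keys f" for u
      using that by (simp add: vkernel_def carrier_free_algebra)
    have diff: "f - red f \<in> ?I"
    proof (rule linearF_mem[OF _ ideal_subspace[OF I], where L = "\<lambda>f. f - red f"])
      show "Vector_Spaces.linear scaleF scaleF (\<lambda>f. f - red f)"
        by (simp add: linearF_iff red_def linext.add linext.scale npoly.scale_right_diff_distrib)
    qed (use r keys in \<open>simp add: red_def\<close>)
    have "red f \<in> {f. \<forall>u\<in>Poly_Mapping.keys f. normal_word u}"
      unfolding red_def
    proof (rule linearF_mem[OF linear_linext subspace_keys])
      fix u assume u: "u \<in> Poly_Mapping.keys f"
      show "linext (\<lambda>u. snd (r u) *\<^sub>F mon (fst (r u))) (mon u) \<in> {f. \<forall>u\<in>Poly_Mapping.keys f. normal_word u}"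
        using keys_scaleF[of "snd (r u)" "mon (fst (r u))"] r[OF keys[OF u]] by auto
    qed
    then have "\<forall>u\<in>Poly_Mapping.keys (red f). normal_word u" by simp
    moreover have "f - (f - red f) \<in> vkernel"
      by (rule npoly.subspace_diff[OF subspace_vkernel f IK[THEN subsetD, OF diff]])
    then have "nform q (expand n d (red f)) = 0" by (simp add: vkernel_def)
    ultimately have "red f = 0" by (rule expand_normal_inj)
    with diff show "f \<in> ?I" by simp
  qed
qed

text \<open>Both words have the same sorted expansion, so the normal form of the relation is a
  multiple of one monomial and membership is one scalar equation.\<close>

lemma rel_in_vkernel_iff:
  assumes "a \<le> N" "b \<le> N" "i \<le> N" "j \<le> N" "sort (w a @ w b) = sort (w i @ w j)"
  shows "rel a b i j c \<in> vkernel \<longleftrightarrow> phi n q d a b = c * phi n q d i j"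
proof -
  have "rel a b i j c \<in> carrier (free_algebra N)"
    unfolding rel_def using assms
    by (intro npoly.subspace_diff[OF subspace_carrier] npoly.subspace_scale[OF subspace_carrier]) auto
  moreover have "nform q (expand n d (rel a b i j c)) =
      (phi n q d a b - c * phi n q d i j) *\<^sub>F mon (sort (w a @ w b))"
    using assms by (simp add: rel_def expand.diff expand.scale nform.diff nform.scale nform_mon phi_eq
        npoly.scale_left_diff_distrib del: sort_append)
  ultimately show ?thesis by (simp add: vkernel_def)
qed

lemma nf_rel_vkernel:
  assumes "a \<le> N" "b \<le> N"
  shows "nf_rel n q d (a, b) \<in> vkernel"
proof -
  obtain i j where ij: "nf_pair n d a b = (i, j)" by force
  with nf_pair[OF assms] have "(i, j) \<in> Cpairs n d" "w i @ w j = sort (w a @ w b)" by auto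
  then show ?thesis
    using rel_in_vkernel_iff[of a b i j "phi n q d a b"] assms ij
    by (simp add: nf_rel_def phi_Cpairs Cpairs_iff sorted_sort_id)
qed

end

section \<open>The two presentations\<close>

lemma mdeg_sort: "mdeg (sort u) = mdeg u"
proof -
  have "count (mset (sort u)) s = count (mset u) s" for s by simp
  then show ?thesis unfolding mdeg_def count_mset by blast
qed

text \<open>Strictly descending and weakly ascending pairs together exhaust all ordered pairs of
  indices; this gives the total number of relations.\<close>

lemma choose_two_square: "(Suc m choose 2) + (m + 2 choose 2) = (m + 1)\<^sup>2"
  by (induction m) (simp_all add: numeral_2_eq_2)

context quantum_veronese
begin

lemma R_union: "R1 n q d \<union> R2 n q d = nf_rel n q d ` red_pairs"
  by (simp add: R1_eq R2_eq red_pairs_def image_Un)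

lemma R_disjoint: "R1 n q d \<inter> R2 n q d = {}"
  unfolding R1_eq R2_eq using inj_nf_rel desc_MV_disjoint
  by (subst inj_on_image_Int[symmetric, of _ red_pairs]) (auto simp: red_pairs_def)

lemma card_R1: "card (R1 n q d) = (N + 1) choose 2"
  unfolding R1_eq using inj_on_subset[OF inj_nf_rel, of "desc_pairs N"]
  by (simp add: card_image card_desc_pairs red_pairs_def)

lemma card_R2: "int (card (R2 n q d)) = int ((N + 2) choose 2) - int ((n + 2 * d) choose n)"
  unfolding R2_eq using inj_on_subset[OF inj_nf_rel, of "MVpairs n d"]
  by (simp add: card_image card_MVpairs red_pairs_def)

lemma finite_R: "finite (R1 n q d \<union> R2 n q d)"
  by (simp add: R_union finite_red_pairs)

lemma card_R: "int (card (R1 n q d \<union> R2 n q d)) = (int N + 1)\<^sup>2 - int ((n + 2 * d) choose n)"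
proof -
  have "int (card (R1 n q d \<union> R2 n q d)) = int (card (R1 n q d)) + int (card (R2 n q d))"
    using finite_R by (simp add: card_Un_disjoint R_disjoint)
  also have "\<dots> = int ((Suc N choose 2) + (N + 2 choose 2)) - int ((n + 2 * d) choose n)"
    by (simp only: card_R1 card_R2) simp
  finally show ?thesis by (simp only: choose_two_square) simp
qed

lemma nf_rel_homogeneous: "p \<in> red_pairs \<Longrightarrow> nf_rel n q d p \<in> homogeneous N 2"
proof -
  assume p: "p \<in> red_pairs"
  obtain a b where ab: "p = (a, b)" by force
  obtain i j where ij: "nf_pair n d a b = (i, j)" by force
  have "(i, j) \<in> Cpairs n d" using nf_pair(1)[of a b] p ab ij by (simp add: red_pairs_iff)
  then show ?thesis
    using p ab unfolding ab nf_rel_eq ij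
    by (intro npoly.subspace_diff npoly.subspace_scale subspace_homogeneous)
      (auto simp: red_pairs_iff Cpairs_iff)
qed

lemma R_homogeneous: "R1 n q d \<union> R2 n q d \<subseteq> homogeneous N 2"
  using nf_rel_homogeneous by (auto simp: R_union)

lemma R_vkernel: "R1 n q d \<union> R2 n q d \<subseteq> vkernel"
  using nf_rel_vkernel by (auto simp: R_union red_pairs_iff)

lemma vkernel_eq_R: "vkernel = Idl\<^bsub>free_algebra N\<^esub> (R1 n q d \<union> R2 n q d)"
proof (rule vkernel_eq_Idl[OF R_vkernel])
  have "R1 n q d \<union> R2 n q d \<subseteq> carrier (free_algebra N)"
    using R_homogeneous homogeneous_carrier by blast
  from fa.genideal_self[OF this]
  show "nf_rel n q d p \<in> Idl\<^bsub>free_algebra N\<^esub> (R1 n q d \<union> R2 n q d)" if "p \<in> red_pairs" for p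
    using that by (auto simp: R_union)
qed

lemma complete_R: "complete_relations n q d (R1 n q d \<union> R2 n q d)"
  using R_homogeneous homogeneous_carrier[of N 2]
  by (auto simp: complete_relations_def a_kernel_eq simp flip: vkernel_eq_R)

lemma independent_R: "npoly.independent (R1 n q d \<union> R2 n q d)"
proof (rule independent_distinct_LM)
  show "0 \<notin> R1 n q d \<union> R2 n q d"
    using nf_rel_nonzero by (auto simp: R_union)
  show "inj_on LM (R1 n q d \<union> R2 n q d)"
    unfolding R_union by (rule inj_onI) (auto simp: LM_nf_rel)
qed

section \<open>The commutation relations between generators\<close>

lemma sort_swap: "sort (w j @ w i) = sort (w i @ w j)"
  by (rule properties_for_sort) simp_all

lemma gcoeff_nonzero: "i \<le> N \<Longrightarrow> j \<le> N \<Longrightarrow> gcoeff n q d j i \<noteq> 0"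
  by (simp add: gcoeff_def phi_nonzero)

lemma swap_rel_vkernel_iff:
  assumes "i < j" "j \<le> N"
  shows "rel j i i j g \<in> vkernel \<longleftrightarrow> g = gcoeff n q d j i"
  using rel_in_vkernel_iff[of j i i j g] assms phi_nonzero[of i j]
  by (auto simp: sort_swap gcoeff_def field_simps)

lemma R1'_vkernel: "R1' n q d \<subseteq> vkernel"
  using swap_rel_vkernel_iff by (auto simp: R1'_def)

lemma R1'_eq: "R1' n q d = (\<lambda>(j, i). rel j i i j (gcoeff n q d j i)) ` desc_pairs N"
  by (force simp: R1'_def desc_pairs_def)

lemma LM_swap_rel: "i < j \<Longrightarrow> LM (rel j i i j c) = [j, i]" for i j :: nat
  unfolding rel_def by (rule LM_binomial) (simp add: Cons_less_Cons)

lemma swap_rel_nonzero: "i < j \<Longrightarrow> rel j i i j c \<noteq> 0" for i j :: nat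
  unfolding rel_def by (rule binomial_nonzero) (simp add: Cons_less_Cons)

lemma card_R1': "card (R1' n q d) = (N + 1) choose 2"
proof -
  have "inj_on (\<lambda>(j, i). rel j i i j (gcoeff n q d j i)) (desc_pairs N)"
  proof (rule inj_onI, clarify)
    fix j i j' i'
    assume "(j, i) \<in> desc_pairs N" "(j', i') \<in> desc_pairs N"
      and eq: "rel j i i j (gcoeff n q d j i) = rel j' i' i' j' (gcoeff n q d j' i')"
    then have "[j, i] = [j', i']"
      unfolding desc_pairs_def using LM_swap_rel by (metis (no_types, lifting) case_prodD mem_Collect_eq)
    then show "j = j' \<and> i = i'" by simp
  qed
  then show ?thesis by (simp add: R1'_eq card_image card_desc_pairs)
qed

lemma independent_R': "npoly.independent (R1' n q d \<union> R2 n q d)"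
proof (rule independent_distinct_LM)
  \<comment> \<open>The second family is also indexed by \<open>red_pairs\<close>: swap relations
    replace \<open>nf_rel\<close> on descending pairs, and the leading words stay the same.\<close>
  define r where "r p = (if p \<in> desc_pairs N
      then rel (fst p) (snd p) (snd p) (fst p) (gcoeff n q d (fst p) (snd p)) else nf_rel n q d p)" for p
  have "R1' n q d = r ` desc_pairs N"
    unfolding R1'_eq by (intro image_cong) (auto simp: r_def)
  moreover have "R2 n q d = r ` MVpairs n d"
    unfolding R2_eq using desc_MV_disjoint by (intro image_cong) (auto simp: r_def)
  ultimately have R: "R1' n q d \<union> R2 n q d = r ` red_pairs"
    by (simp add: red_pairs_def image_Un)
  have LM: "LM (r p) = [fst p, snd p]" if "p \<in> red_pairs" for p
    using that LM_nf_rel[OF that] by (auto simp: r_def desc_pairs_def LM_swap_rel)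
  then show "inj_on LM (R1' n q d \<union> R2 n q d)"
    unfolding R by (intro inj_onI) (auto simp: prod_eq_iff)
  have "r p \<noteq> 0" if "p \<in> red_pairs" for p
    using nf_rel_nonzero[OF that] swap_rel_nonzero by (auto simp: r_def desc_pairs_def)
  then show "0 \<notin> R1' n q d \<union> R2 n q d"
    unfolding R by force
qed

lemma R'_carrier: "R1' n q d \<union> R2 n q d \<subseteq> carrier (free_algebra N)"
  using R1'_vkernel R_vkernel by (auto simp: vkernel_def)

text \<open>With g = phi_ji / phi_ij, the relation for (j, i) is the swap relation plus g times the
  relation for (i, j): the terms in w_i w_j cancel, and g phi_ij = phi_ji is the coefficient that
  remains.\<close>

lemma R1_in_Idl_R': "R1 n q d \<subseteq> Idl\<^bsub>free_algebra N\<^esub> (R1' n q d \<union> R2 n q d)" (is "_ \<subseteq> ?I")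
proof
  fix r assume "r \<in> R1 n q d"
  then obtain i j where ij: "i < j" "j \<le> N" and r: "r = nf_rel n q d (j, i)"
    by (auto simp: R1_eq desc_pairs_def)
  note sub = fa.genideal_self[OF R'_carrier]
  note I = ideal_subspace[OF fa.genideal_ideal[OF R'_carrier]]
  let ?g = "gcoeff n q d j i"
  obtain i' j' where p: "nf_pair n d i j = (i', j')" by force
  \<comment> \<open>The normal pair depends only on the sorted rearrangement, which is the same for
    both orders of the factors.\<close>
  have p': "nf_pair n d j i = (i', j')"
    using p by (simp add: nf_pair_def sort_swap)
  have 1: "rel j i i j ?g \<in> ?I"
    using ij sub by (auto simp: R1'_def)
  have 2: "nf_rel n q d (i, j) \<in> ?I"
  proof (cases "(i, j) \<in> Cpairs n d")
    case True
    then have "nf_pair n d i j = (i, j)"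
      by (intro nf_pair_eqI) (auto simp: Cpairs_iff sorted_sort_id)
    with True have "nf_rel n q d (i, j) = 0" by (simp add: nf_rel_eq phi_Cpairs)
    with npoly.subspace_0[OF I] show ?thesis by simp
  next
    case False
    with ij have "(i, j) \<in> MVpairs n d" by (auto simp: MVpairs_iff Cpairs_iff)
    with sub show ?thesis by (auto simp: R2_eq)
  qed
  have "r = rel j i i j ?g + ?g *\<^sub>F nf_rel n q d (i, j)"
    using phi_nonzero[of i j] ij
    by (simp add: r rel_def nf_rel_eq p p' npoly.scale_right_diff_distrib gcoeff_def)
  with npoly.subspace_add[OF I 1 npoly.subspace_scale[OF I 2]] show "r \<in> ?I" by simp
qed

lemma complete_R': "complete_relations n q d (R1' n q d \<union> R2 n q d)"
proof -
  have "vkernel = Idl\<^bsub>free_algebra N\<^esub> (R1' n q d \<union> R2 n q d)"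
  proof (rule vkernel_eq_Idl)
    show "R1' n q d \<union> R2 n q d \<subseteq> vkernel" using R1'_vkernel R_vkernel by auto
    show "nf_rel n q d p \<in> Idl\<^bsub>free_algebra N\<^esub> (R1' n q d \<union> R2 n q d)" if "p \<in> red_pairs" for p
      using that R1_in_Idl_R' fa.genideal_self[OF R'_carrier] R_union by blast
  qed
  then show ?thesis using R'_carrier by (simp add: complete_relations_def a_kernel_eq)
qed

section \<open>The clauses about individual relations\<close>

lemma normal_pair_props:
  assumes ab: "(a, b) \<in> red_pairs" and np: "normal_pair n q d a b i j c"
  shows "c = phi n q d a b" "mdeg (w a @ w b) = mdeg (w i @ w j)"
    "w i @ w j = Tmon n (mdeg (w a @ w b))"
    "w i @ w j \<in> ordered_monomials n (2 * d)"
    "LM (expand n d (rel a b i j c)) = w a @ w b"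
    "w a @ w b > w i @ w j"
proof -
  from ab have le: "a \<le> N" "b \<le> N" by (simp_all add: red_pairs_iff)
  from np have ij: "nf_pair n d a b = (i, j)" and c: "c = phi n q d a b"
    by (simp_all add: normal_pair_iff[OF le])
  from nf_pair[OF le] ij have C: "(i, j) \<in> Cpairs n d" and s: "w i @ w j = sort (w a @ w b)" by auto
  have set: "set (w a @ w b) \<subseteq> {..n}" using w_props(2) le by simp
  show "c = phi n q d a b" by fact
  show "mdeg (w a @ w b) = mdeg (w i @ w j)" by (simp only: s mdeg_sort)
  show "w i @ w j = Tmon n (mdeg (w a @ w b))" by (simp only: s Tmon_mdeg[OF set])
  show "w i @ w j \<in> ordered_monomials n (2 * d)"
    unfolding s ordered_monomials_eq using set le by (simp add: w_props)
  show less: "w a @ w b > w i @ w j" by (rule nf_pair_less(1)[OF ab ij])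
  show "LM (expand n d (rel a b i j c)) = w a @ w b"
    using LM_binomial[OF less, of c] by (simp add: rel_def expand.diff expand.scale)
qed

text \<open>If \<open>i = j\<close>, sortedness of \<open>w i @ w i\<close> makes \<open>w i\<close>
  a power of one letter. Then \<open>w a @ w b\<close> uses that letter only and is already sorted,
  contrary to the choice of the pair.\<close>

lemma normal_pair_less:
  assumes "(a, b) \<in> MVpairs n d" "normal_pair n q d a b i j c"
  shows "i < j"
proof (rule ccontr)
  assume "\<not> i < j"
  from assms(1) have ab: "a \<le> N" "b \<le> N" "\<not> sorted (w a @ w b)" by (auto simp: MVpairs_iff)
  from assms(2) nf_pair[OF ab(1,2)] have C: "(i, j) \<in> Cpairs n d" and s: "w i @ w j = sort (w a @ w b)"
    by (auto simp: normal_pair_iff[OF ab(1,2)] dest: sym)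
  from C \<open>\<not> i < j\<close> have "i = j" by (auto simp: Cpairs_def Ppairs_def)
  with C have const: "x \<le> y" if "x \<in> set (w i)" "y \<in> set (w i)" for x y
    using that by (auto simp: Cpairs_iff sorted_append)
  have "set (w a @ w b) = set (w i)"
    using arg_cong[OF s, of set] \<open>i = j\<close> by simp
  with const have "sorted (w a @ w b)"
    by (intro sorted_iff_nth_mono[THEN iffD2]) (metis nth_mem le_less_trans)
  with ab show False by simp
qed

lemma ex1_rel:
  assumes "(a, b) \<in> P" "P \<subseteq> red_pairs"
  shows "\<exists>!r. r \<in> nf_rel n q d ` P \<and> [a, b] \<in> Poly_Mapping.keys r"
proof (rule ex1I[of _ "nf_rel n q d (a, b)"])
  show "nf_rel n q d (a, b) \<in> nf_rel n q d ` P \<and> [a, b] \<in> Poly_Mapping.keys (nf_rel n q d (a, b))"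
    using assms in_keys_nf_rel[of a b a b] by auto
  show "r = nf_rel n q d (a, b)" if "r \<in> nf_rel n q d ` P \<and> [a, b] \<in> Poly_Mapping.keys r" for r
    using that assms in_keys_nf_rel[of _ _ a b] by (auto simp: subset_iff)
qed

lemma ex1_normal_pair:
  assumes "a \<le> N" "b \<le> N"
  shows "\<exists>!t. case t of (i, j, c) \<Rightarrow> normal_pair n q d a b i j c"
  by (rule ex1I[of _ "(fst (nf_pair n d a b), snd (nf_pair n d a b), phi n q d a b)"])
    (auto simp: normal_pair_iff[OF assms] split: prod.splits dest: sym)

lemma Cpairs_ordered: "(i, j) \<in> Cpairs n d \<Longrightarrow> w i @ w j \<in> ordered_monomials n (2 * d)"
  using w_props(2)[of i] w_props(2)[of j] by (auto simp: Cpairs_iff ordered_monomials_eq w_props)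

lemma Cpairs_rel_R1:
  assumes "(i, j) \<in> Cpairs n d" "i < j"
  shows "rel j i i j (phi n q d j i) \<in> R1 n q d"
proof -
  have "nf_pair n d j i = (i, j)"
    using assms by (intro nf_pair_eqI) (auto simp: Cpairs_iff sort_swap sorted_sort_id)
  then have "rel j i i j (phi n q d j i) = nf_rel n q d (j, i)" by (simp add: nf_rel_def)
  with assms show ?thesis by (auto simp: R1_eq desc_pairs_def Cpairs_iff)
qed

end

theorem theorem4p5:
  fixes n d N :: nat and q :: "nat \<Rightarrow> nat \<Rightarrow> complex"
  assumes d: "d \<ge> 1"
    and q: "mult_antisym n q"
    and N: "N = Nver n d"
  shows
    "(card (ordered_monomials n d) = (n + d) choose d \<and>
     bij_betw (wd n d) {..N} (ordered_monomials n d) \<and>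
     strict_mono_on {..N} (wd n d) \<and>
     wd n d 0 = replicate d 0 \<and> wd n d N = replicate d n) \<and>
     (subring (veronese n q d) (qspace n q) \<and>
     veronese_map n q d \<in> ring_hom (free_algebra N) (veronese_ring n q d) \<and>
     veronese_map n q d ` carrier (free_algebra N) = veronese n q d \<and>
     (\<forall>k. veronese_map n q d ` homogeneous N k = qcomponent n q (k * d)) \<and>
     R1 n q d \<union> R2 n q d \<subseteq> homogeneous N 2 \<and>
     complete_relations n q d (R1 n q d \<union> R2 n q d) \<and>
     npoly.independent (R1 n q d \<union> R2 n q d) \<and>
     finite (R1 n q d \<union> R2 n q d) \<and>
     int (card (R1 n q d \<union> R2 n q d)) = (int N + 1)\<^sup>2 - int ((n + 2 * d) choose n) \<and>
     R1 n q d \<inter> R2 n q d = {}) \<and>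
     (card (R1 n q d) = (N + 1) choose 2 \<and>
     (\<forall>i j. i < j \<and> j \<le> N \<longrightarrow>
        (\<exists>!r. r \<in> R1 n q d \<and> [j, i] \<in> Poly_Mapping.keys r) \<and>
        (\<exists>!t. case t of (i', j', c) \<Rightarrow> normal_pair n q d j i i' j' c) \<and>
        (\<forall>i' j' c. normal_pair n q d j i i' j' c \<longrightarrow>
           c = phi n q d j i \<and>
           mdeg (wd n d j @ wd n d i) = mdeg (wd n d i' @ wd n d j') \<and>
           wd n d i' @ wd n d j' = Tmon n (mdeg (wd n d j @ wd n d i)) \<and>
           wd n d i' @ wd n d j' \<in> ordered_monomials n (2 * d) \<and>
           LM (expand n d (rel j i i' j' c)) = wd n d j @ wd n d i \<and>
           wd n d j @ wd n d i > wd n d i' @ wd n d j')) \<and>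
     (\<forall>i j. (i, j) \<in> Cpairs n d \<and> i < j \<longrightarrow>
        wd n d i @ wd n d j \<in> ordered_monomials n (2 * d) \<and>
        rel j i i j (phi n q d j i) \<in> R1 n q d)) \<and>
     (int (card (R2 n q d)) = int ((N + 2) choose 2) - int ((n + 2 * d) choose n) \<and>
     (\<forall>(i, j) \<in> MVpairs n d.
        (\<exists>!r. r \<in> R2 n q d \<and> [i, j] \<in> Poly_Mapping.keys r) \<and>
        (\<exists>!t. case t of (i', j', c) \<Rightarrow> normal_pair n q d i j i' j' c) \<and>
        (\<forall>i' j' c. normal_pair n q d i j i' j' c \<longrightarrow>
           i' < j' \<and> c = phi n q d i j \<and>
           mdeg (wd n d i @ wd n d j) = mdeg (wd n d i' @ wd n d j') \<and>
           wd n d i' @ wd n d j' = Tmon n (mdeg (wd n d i @ wd n d j)) \<and>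
           wd n d i' @ wd n d j' \<in> ordered_monomials n (2 * d) \<and>
           LM (expand n d (rel i j i' j' c)) = wd n d i @ wd n d j \<and>
           wd n d i @ wd n d j > wd n d i' @ wd n d j'))) \<and>
     (R1' n q d \<subseteq> Idl\<^bsub>free_algebra N\<^esub> (R1 n q d \<union> R2 n q d) \<and>
     card (R1' n q d) = (N + 1) choose 2 \<and>
     (\<forall>(i, j) \<in> Cpairs n d. phi n q d i j = 1) \<and>
     (\<forall>i j. i < j \<and> j \<le> N \<longrightarrow>
        gcoeff n q d j i \<noteq> 0 \<and>
        (\<forall>g. rel j i i j g \<in> Idl\<^bsub>free_algebra N\<^esub> (R1 n q d \<union> R2 n q d) \<longleftrightarrow>
             g = gcoeff n q d j i))) \<and>
     (R1 n q d \<subseteq> Idl\<^bsub>free_algebra N\<^esub> (R1' n q d \<union> R2 n q d) \<and>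
     complete_relations n q d (R1' n q d \<union> R2 n q d) \<and>
     npoly.independent (R1' n q d \<union> R2 n q d))"
proof -
  interpret quantum_veronese n d q by unfold_locales (rule d, rule q)
  have R1_block: "(\<exists>!r. r \<in> R1 n q d \<and> [j, i] \<in> Poly_Mapping.keys r) \<and>
      (\<exists>!t. case t of (i', j', c) \<Rightarrow> normal_pair n q d j i i' j' c) \<and>
      (\<forall>i' j' c. normal_pair n q d j i i' j' c \<longrightarrow>
         c = phi n q d j i \<and>
         mdeg (wd n d j @ wd n d i) = mdeg (wd n d i' @ wd n d j') \<and>
         wd n d i' @ wd n d j' = Tmon n (mdeg (wd n d j @ wd n d i)) \<and>
         wd n d i' @ wd n d j' \<in> ordered_monomials n (2 * d) \<and>
         LM (expand n d (rel j i i' j' c)) = wd n d j @ wd n d i \<and>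
         wd n d j @ wd n d i > wd n d i' @ wd n d j')"
    if "i < j \<and> j \<le> Nver n d" for i j
  proof -
    from that have ji: "(j, i) \<in> desc_pairs (Nver n d)" "(j, i) \<in> red_pairs"
      by (auto simp: desc_pairs_def red_pairs_def)
    moreover have "\<exists>!r. r \<in> R1 n q d \<and> [j, i] \<in> Poly_Mapping.keys r"
      unfolding R1_eq by (rule ex1_rel[OF ji(1)]) (simp add: red_pairs_def)
    ultimately show ?thesis
      using that normal_pair_props[OF ji(2)] ex1_normal_pair[of j i] by simp
  qed
  have R2_block: "case p of (i, j) \<Rightarrow> (\<exists>!r. r \<in> R2 n q d \<and> [i, j] \<in> Poly_Mapping.keys r) \<and>
      (\<exists>!t. case t of (i', j', c) \<Rightarrow> normal_pair n q d i j i' j' c) \<and>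
      (\<forall>i' j' c. normal_pair n q d i j i' j' c \<longrightarrow>
         i' < j' \<and> c = phi n q d i j \<and>
         mdeg (wd n d i @ wd n d j) = mdeg (wd n d i' @ wd n d j') \<and>
         wd n d i' @ wd n d j' = Tmon n (mdeg (wd n d i @ wd n d j)) \<and>
         wd n d i' @ wd n d j' \<in> ordered_monomials n (2 * d) \<and>
         LM (expand n d (rel i j i' j' c)) = wd n d i @ wd n d j \<and>
         wd n d i @ wd n d j > wd n d i' @ wd n d j')"
    if "p \<in> MVpairs n d" for p
  proof -
    obtain i j where p: "p = (i, j)" by force
    with that have ij: "(i, j) \<in> MVpairs n d" "(i, j) \<in> red_pairs"
      by (auto simp: red_pairs_def)
    moreover have "\<exists>!r. r \<in> R2 n q d \<and> [i, j] \<in> Poly_Mapping.keys r"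
      unfolding R2_eq by (rule ex1_rel[OF ij(1)]) (simp add: red_pairs_def)
    ultimately show ?thesis
      using normal_pair_props[OF ij(2)] normal_pair_less[OF ij(1)] ex1_normal_pair[of i j]
      by (simp add: p red_pairs_iff)
  qed
  have C_block: "wd n d i @ wd n d j \<in> ordered_monomials n (2 * d) \<and>
      rel j i i j (phi n q d j i) \<in> R1 n q d" if "(i, j) \<in> Cpairs n d \<and> i < j" for i j
    using that Cpairs_ordered Cpairs_rel_R1 by blast
  \<comment> \<open>Uniqueness of the coefficient is inherited from the kernel: the ideal equals it,
    and membership there is a scalar equation for \<open>g\<close>.\<close>
  have g_block: "gcoeff n q d j i \<noteq> 0 \<and>
      (\<forall>g. rel j i i j g \<in> Idl\<^bsub>free_algebra (Nver n d)\<^esub> (R1 n q d \<union> R2 n q d) \<longleftrightarrow>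
        g = gcoeff n q d j i)" if "i < j \<and> j \<le> Nver n d" for i j
    using that gcoeff_nonzero[of i j] swap_rel_vkernel_iff[of i j] by (simp flip: vkernel_eq_R)
  have phi_block: "\<forall>(i, j)\<in>Cpairs n d. phi n q d i j = 1"
    using phi_Cpairs by blast
  show ?thesis
    unfolding N
    by (intro conjI allI impI ballI card_ordered_monomials bij_betw_wd strict_mono_wd w_0 w_N
        subring_veronese veronese_map_veronese_ring veronese_map_image veronese_map_homogeneous
        R_homogeneous complete_R independent_R finite_R card_R R_disjoint card_R1 R1_block C_block
        card_R2 R2_block R1'_vkernel[unfolded vkernel_eq_R] card_R1' phi_block g_block
        R1_in_Idl_R' complete_R' independent_R'; blast)
qed

end
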